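(* For the Gaussian cooling function $g(h)=e^{-h^2}$, the maximal real evolution time $t_m=\tau x_m$ (time/circuit complexity) and the sample number $N_M$ (sample complexity) sufficient to estimate $\langle O\rangle=\langle u_j|O|u_j\rangle$ within error $\varepsilon\|O\|_1$ (with a fixed failure probability) scale as $$t_m= O\!\left(\Delta^{-1}\log\frac{1}{\varepsilon p_j}\right),\qquad N_M= O\!\left(\frac{1}{(\varepsilon p_j)^{2}}\right).$$
   Context: System. $H$ is a Hamiltonian (Hermitian operator) on $n$ qubits, $N=2^n$, with orthonormal eigenvectors $|u_i\rangle$ and eigenvalues $E_0<E_1<\dots<E_{N-1}$. An index $j$ is fixed; $\Delta=\min\{|E_{j-1}-E_j|,|E_{j+1}-E_j|\}$ (a neighbour that does not exist is omitted). $|\psi_0\rangle$ is a unit vector and $p_j=|\langle u_j|\psi_0\rangle|^2>0$. The eigenvalue $E_j$ is known exactly. $\varepsilon\in(0,1)$. Sampling density. For $g(h)=e^{-h^2}$, the Fourier transform is $f(x)=\int g(h)e^{-ixh}dh=\sqrt\pi e^{-x^2/4}$, and $p(x)=f(x)/2\pi$ is a probability density with $g(h)=\int p(x)e^{ixh}\,dx$; $\tilde p(y)=\int p(t-y)p(t)\,dt$. Observable. $O=\sum_l o_lP_l$ is a Hermitian operator with $o_l>0$ and each $P_l$ an $n$-qubit Pauli string up to sign; $\|O\|_1=\sum_l|o_l|$ and $\Pr_O(l)=o_l/\|O\|_1$. Estimators, with parameters $\tau>0$ (imaginary time), $x_m>0$ (normalized cutoff time), $N_M$ (number of samples). A Hadamard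 test for a unitary $U$ means: draw $b\in\{0,1\}$ uniformly, then $a\in\{0,1\}$ with $\Pr(a=0\mid b=0)=\frac12(1+\mathrm{Re}\langle\psi_0|U|\psi_0\rangle)$ and $\Pr(a=0\mid b=1)=\frac12(1+\mathrm{Im}\langle\psi_0|U|\psi_0\rangle)$. One sample $\hat d$: draw $y\sim\tilde p$; if $|y|>x_m$ set $\hat d=0$; otherwise do a Hadamard test with $U=e^{i\tau yH}$ and set $\hat d=\mathrm{Re}\big(2\,i^b(-1)^a e^{-i\tau yE_j}\big)$. $\hat D_\tau^{(x_m)}$ is the average of $N_M$ i.i.d. copies. One sample $\hat n$: draw independent $x,x'\sim p$ and $l\sim\Pr_O$; if $|x|>x_m$ or $|x'|>x_m$ set $\hat n=0$; otherwise do a Hadamard test with $U=e^{-i\tau x'H}P_le^{i\tau xH}$ and set $\hat n=\mathrm{Re}\big(2\|O\|_1\,i^b(-1)^a e^{-i\tau(x-x')E_j}\big)$. $\hat N_\tau^{(x_m)}(O)$ is the average of $N_M$ i.i.d. copies. The estimate of $\langle O\rangle$ is $\hat N_\tau^{(x_m)}(O)/\hat D_\tau^{(x_m)}$. *)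

theory Defs
  imports
    "HOL-Probability.Probability"
    "HOL-Library.Landau_Symbols"
    "HOL-Library.Monad_Syntax"
    "Jordan_Normal_Form.Schur_Decomposition"
begin

text \<open>States and operators on \<open>n\<close> qubits are vectors and matrices of dimension \<open>2 ^ n\<close>.\<close>

definition braket :: "complex vec \<Rightarrow> complex vec \<Rightarrow> complex" where
  "braket v w = w \<bullet>c v"

definition expectation_val :: "complex vec \<Rightarrow> complex mat \<Rightarrow> complex" where
  "expectation_val \<psi> A = braket \<psi> (A *\<^sub>v \<psi>)"

definition hermitian_mat :: "complex mat \<Rightarrow> bool" where
  "hermitian_mat A \<longleftrightarrow> mat_adjoint A = A"

definition mat_exp :: "complex mat \<Rightarrow> complex mat" where
  "mat_exp A = mat (dim_row A) (dim_col A) (\<lambda>(i, j). \<Sum>m. (A ^\<^sub>m m) $$ (i, j) / fact m)"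


definition eigensystem ::
  "nat \<Rightarrow> complex mat \<Rightarrow> (nat \<Rightarrow> real) \<Rightarrow> (nat \<Rightarrow> complex vec) \<Rightarrow> bool" where
  "eigensystem n H E u \<longleftrightarrow>
     (\<forall>i<2 ^ n. u i \<in> carrier_vec (2 ^ n) \<and> H *\<^sub>v u i = complex_of_real (E i) \<cdot>\<^sub>v u i) \<and>
     (\<forall>i<2 ^ n. \<forall>k<2 ^ n. braket (u i) (u k) = (if i = k then 1 else 0)) \<and>
     strict_mono_on {..<2 ^ n} E"

definition spectral_gap :: "nat \<Rightarrow> (nat \<Rightarrow> real) \<Rightarrow> nat \<Rightarrow> real" where
  "spectral_gap n E j = Min {\<bar>E k - E j\<bar> | k. k < 2 ^ n \<and> (k + 1 = j \<or> k = j + 1)}"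


datatype pauli = PauliI | PauliX | PauliY | PauliZ

fun pauli_mat :: "pauli \<Rightarrow> complex mat" where
  "pauli_mat PauliI = mat_of_rows_list 2 [[1, 0], [0, 1]]"
| "pauli_mat PauliX = mat_of_rows_list 2 [[0, 1], [1, 0]]"
| "pauli_mat PauliY = mat_of_rows_list 2 [[0, - \<i>], [\<i>, 0]]"
| "pauli_mat PauliZ = mat_of_rows_list 2 [[1, 0], [0, - 1]]"

definition kronecker :: "complex mat \<Rightarrow> complex mat \<Rightarrow> complex mat" where
  "kronecker A B = mat (dim_row A * dim_row B) (dim_col A * dim_col B)
     (\<lambda>(i, j). A $$ (i div dim_row B, j div dim_col B) * B $$ (i mod dim_row B, j mod dim_col B))"

definition pauli_string :: "pauli list \<Rightarrow> complex mat" where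
  "pauli_string ps = foldr (\<lambda>s. kronecker (pauli_mat s)) ps (1\<^sub>m 1)"

definition signed_pauli_string :: "nat \<Rightarrow> complex mat \<Rightarrow> bool" where
  "signed_pauli_string n P \<longleftrightarrow>
     (\<exists>ps. length ps = n \<and> (P = pauli_string ps \<or> P = - pauli_string ps))"

definition pauli_sum :: "nat \<Rightarrow> nat \<Rightarrow> (nat \<Rightarrow> real) \<Rightarrow> (nat \<Rightarrow> complex mat) \<Rightarrow> complex mat" where
  "pauli_sum n L c P = mat (2 ^ n) (2 ^ n) (\<lambda>(i, j). \<Sum>l<L. complex_of_real (c l) * P l $$ (i, j))"

text \<open>\<open>obs\<close> is the sum of the \<open>c l\<close>-multiples of the signed Pauli strings \<open>P l\<close>, \<open>l < L\<close>.
  At least one term is needed for the term-sampling distribution to exist.\<close>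

definition pauli_observable ::
  "nat \<Rightarrow> complex mat \<Rightarrow> nat \<Rightarrow> (nat \<Rightarrow> real) \<Rightarrow> (nat \<Rightarrow> complex mat) \<Rightarrow> bool" where
  "pauli_observable n obs L c P \<longleftrightarrow>
     0 < L \<and> (\<forall>l<L. 0 < c l \<and> signed_pauli_string n (P l)) \<and>
     obs = pauli_sum n L c P \<and> hermitian_mat obs"

definition one_norm :: "nat \<Rightarrow> (nat \<Rightarrow> real) \<Rightarrow> real" where
  "one_norm L c = (\<Sum>l<L. \<bar>c l\<bar>)"

definition term_pmf :: "nat \<Rightarrow> (nat \<Rightarrow> real) \<Rightarrow> nat pmf" where
  "term_pmf L c = embed_pmf (\<lambda>l. if l < L then c l / one_norm L c else 0)"


definition gaussian_cooling :: "real \<Rightarrow> real" where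
  "gaussian_cooling h = exp (- h\<^sup>2)"

definition fourier :: "(real \<Rightarrow> real) \<Rightarrow> real \<Rightarrow> complex" where
  "fourier g x = (LINT h|lborel. complex_of_real (g h) * exp (- \<i> * complex_of_real x * complex_of_real h))"

text \<open>The transform of an even function such as the Gaussian is real, so the real part below
  discards nothing; see \<open>fourier_gaussian_cooling\<close>.\<close>

definition sampling_density :: "(real \<Rightarrow> real) \<Rightarrow> real \<Rightarrow> real" where
  "sampling_density g x = Re (fourier g x) / (2 * pi)"

definition autocorrelation_density :: "(real \<Rightarrow> real) \<Rightarrow> real \<Rightarrow> real" where
  "autocorrelation_density g y =
     (LINT t|lborel. sampling_density g (t - y) * sampling_density g t)"

lemma fourier_gaussian_cooling:
  "fourier gaussian_cooling x = complex_of_real (sqrt pi * exp (- x\<^sup>2 / 4))"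
proof -
  define s where "s = sqrt (2::real)"
  have s: "s > 0" "s\<^sup>2 = 2" by (auto simp: s_def)
  have ch: "char std_normal_distribution (- x / s) = complex_of_real (exp (- x\<^sup>2 / 4))"
    by (simp add: char_std_normal_distribution power_divide s)
  have "char std_normal_distribution (- x / s) =
      (LINT h|lborel. std_normal_density h *\<^sub>R exp (\<i> * complex_of_real (- x / s * h)))"
    unfolding char_def by (subst integral_density) auto
  also have "\<dots> = s *\<^sub>R (LINT h|lborel. std_normal_density (s * h) *\<^sub>R
        exp (\<i> * complex_of_real (- x / s * (s * h))))"
    using lborel_integral_real_affine[of s
        "\<lambda>h. std_normal_density h *\<^sub>R exp (\<i> * complex_of_real (- x / s * h))" 0] s
    by simp
  also have "(\<lambda>h. std_normal_density (s * h) *\<^sub>R exp (\<i> * complex_of_real (- x / s * (s * h)))) =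
      (\<lambda>h. (1 / sqrt (2 * pi)) *\<^sub>R (complex_of_real (gaussian_cooling h) *
        exp (- \<i> * complex_of_real x * complex_of_real h)))"
    using s by (auto simp: std_normal_density_def gaussian_cooling_def power_mult_distrib
        scaleR_conv_of_real mult_ac)
  also have "s *\<^sub>R (LINT h|lborel. (1 / sqrt (2 * pi)) *\<^sub>R (complex_of_real (gaussian_cooling h) *
        exp (- \<i> * complex_of_real x * complex_of_real h))) = (1 / sqrt pi) *\<^sub>R fourier gaussian_cooling x"
    unfolding fourier_def by (simp add: s_def real_sqrt_mult)
  finally have "(1 / sqrt pi) *\<^sub>R fourier gaussian_cooling x = complex_of_real (exp (- x\<^sup>2 / 4))"
    using ch by simp
  then have "sqrt pi *\<^sub>R ((1 / sqrt pi) *\<^sub>R fourier gaussian_cooling x) =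
      sqrt pi *\<^sub>R complex_of_real (exp (- x\<^sup>2 / 4))"
    by simp
  then show ?thesis
    by (simp add: scaleR_conv_of_real)
qed

lemma sampling_density_gaussian_cooling:
  "sampling_density gaussian_cooling x = sqrt pi * exp (- x\<^sup>2 / 4) / (2 * pi)"
  by (simp add: sampling_density_def fourier_gaussian_cooling)


text \<open>The outcome of a Hadamard test is the pair \<open>(b, a)\<close>. The success probability passed to
  \<open>bernoulli_pmf\<close> lies in the unit interval when \<open>U\<close> is unitary and \<open>\<psi>\<close> is a unit vector.\<close>

definition hadamard_test :: "complex vec \<Rightarrow> complex mat \<Rightarrow> (nat \<times> nat) pmf" where
  "hadamard_test \<psi> U = do {
     b \<leftarrow> pmf_of_set {0, 1};
     a_is_0 \<leftarrow> bernoulli_pmf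
       ((1 + (if b = 0 then Re (expectation_val \<psi> U) else Im (expectation_val \<psi> U))) / 2);
     return_pmf (b, if a_is_0 then 0 else 1)
   }"

definition evolution :: "complex mat \<Rightarrow> real \<Rightarrow> complex mat" where
  "evolution H t = mat_exp ((\<i> * complex_of_real t) \<cdot>\<^sub>m H)"

definition denominator_sample ::
  "(real \<Rightarrow> real) \<Rightarrow> real \<Rightarrow> real \<Rightarrow> complex mat \<Rightarrow> real \<Rightarrow> complex vec \<Rightarrow> real measure" where
  "denominator_sample g \<tau> x\<^sub>m H Ej \<psi> =
     density lborel (\<lambda>y. ennreal (autocorrelation_density g y)) \<bind> (\<lambda>y.
       if \<bar>y\<bar> > x\<^sub>m then return borel 0
       else distr (measure_pmf (hadamard_test \<psi> (evolution H (\<tau> * y)))) borel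
         (\<lambda>(b, a). Re (2 * \<i> ^ b * (- 1) ^ a * exp (- \<i> * complex_of_real (\<tau> * y * Ej)))))"

definition numerator_sample ::
  "(real \<Rightarrow> real) \<Rightarrow> real \<Rightarrow> real \<Rightarrow> complex mat \<Rightarrow> real \<Rightarrow> complex vec \<Rightarrow>
   nat \<Rightarrow> (nat \<Rightarrow> real) \<Rightarrow> (nat \<Rightarrow> complex mat) \<Rightarrow> real measure" where
  "numerator_sample g \<tau> x\<^sub>m H Ej \<psi> L c P =
     (density lborel (\<lambda>x. ennreal (sampling_density g x)) \<Otimes>\<^sub>M
      (density lborel (\<lambda>x. ennreal (sampling_density g x)) \<Otimes>\<^sub>M measure_pmf (term_pmf L c)))
     \<bind> (\<lambda>(x, x', l).
       if \<bar>x\<bar> > x\<^sub>m \<or> \<bar>x'\<bar> > x\<^sub>m then return borel 0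
       else distr (measure_pmf (hadamard_test \<psi> (evolution H (- \<tau> * x') * P l * evolution H (\<tau> * x)))) borel
         (\<lambda>(b, a). Re (2 * complex_of_real (one_norm L c) * \<i> ^ b * (- 1) ^ a *
            exp (- \<i> * complex_of_real (\<tau> * (x - x') * Ej)))))"

text \<open>The law of \<open>M\<close> i.i.d. denominator samples and, independently, \<open>M\<close> i.i.d. numerator samples.\<close>

definition estimation_run ::
  "(real \<Rightarrow> real) \<Rightarrow> real \<Rightarrow> real \<Rightarrow> nat \<Rightarrow> complex mat \<Rightarrow> real \<Rightarrow> complex vec \<Rightarrow>
   nat \<Rightarrow> (nat \<Rightarrow> real) \<Rightarrow> (nat \<Rightarrow> complex mat) \<Rightarrow> ((nat \<Rightarrow> real) \<times> (nat \<Rightarrow> real)) measure" where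
  "estimation_run g \<tau> x\<^sub>m M H Ej \<psi> L c P =
     (\<Pi>\<^sub>M k\<in>{..<M}. denominator_sample g \<tau> x\<^sub>m H Ej \<psi>) \<Otimes>\<^sub>M
     (\<Pi>\<^sub>M k\<in>{..<M}. numerator_sample g \<tau> x\<^sub>m H Ej \<psi> L c P)"

definition average :: "nat \<Rightarrow> (nat \<Rightarrow> real) \<Rightarrow> real" where
  "average M z = (\<Sum>k<M. z k) / real M"

text \<open>A run whose denominator estimate is zero yields no estimate and counts as a failure.\<close>

definition estimation_succeeds ::
  "nat \<Rightarrow> complex \<Rightarrow> real \<Rightarrow> (nat \<Rightarrow> real) \<times> (nat \<Rightarrow> real) \<Rightarrow> bool" where
  "estimation_succeeds M target err = (\<lambda>(d, e). average M d \<noteq> 0 \<and>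
     cmod (complex_of_real (average M e / average M d) - target) \<le> err)"

text \<open>Admissible triples of gap, accuracy and overlap. Big-O relative to the principal filter of
  this set is a bound with one constant for all admissible triples.\<close>

definition cooling_parameters :: "(real \<times> real \<times> real) set" where
  "cooling_parameters = {(\<Delta>, \<epsilon>, p). 0 < \<Delta> \<and> 0 < \<epsilon> \<and> \<epsilon> < 1 \<and> 0 < p \<and> p \<le> 1}"

end

(*
  Expand everything in the eigenbasis of H. Averaging over the Gaussian times replaces the amplitude
  c_i of the initial state by c_i exp(- tau^2 (E_i - E_j)^2), so up to the truncation of the times
  the denominator has mean D = p_j + rho and the numerator has mean <phi|O|phi>, where phi is the
  cooled vector, and rho <= exp(- 2 tau^2 Delta^2) (1 - p_j) is its weight outside u_j. Pauli
  strings are unitary, hence <phi|O|phi> differs from D <u_j|O|u_j> by at most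
  ||O||_1 (2 sqrt(p_j rho) + 2 rho). Gaussian tails bound the truncation error and Hoeffding's
  inequality the statistical error.

  With s = eps p_j, the time tau x_m has to be bounded by ln(1/s) / Delta uniformly, also for
  s -> 1 where this vanishes. Take x_m = sqrt(8 ln(64/s)) and tau = 2000 ln(1/s) / (Delta x_m).
*)
theory Submission
  imports Defs
begin

subsection \<open>Unitarity of Pauli strings\<close>

text \<open>Both estimators target unnormalised quantities: the denominator approaches D = p_j + rho
  and not p_j, so the numerator is compared with D <u_j|O|u_j>, and the normalisation cancels in the
  quotient.

  Dividing dictates the error budget. With s = eps p_j, an error of s/8 in the denominator leaves it
  at least 7/8 p_j, so the errors of the quotient, relative to ||O||_1 and before division, may add
  up to 7/8 s. Denominator and numerator take s/8 each, half for truncation and half for statistics;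
  5/8 s remains for the leakage 2 sqrt(p_j rho) + 2 rho.

  A time that vanishes as s tends to 1 cannot cool there. It does not have to: s <= p_j forces p_j
  close to 1, and rho <= 1 - p_j is then within the budget. Hence the factor 1 - p_j is kept in the
  bound on rho.

  A second obstacle is measurability. The sampling kernels have to be measurable at every point, but
  nothing is known about P l for l >= L, not even its dimensions. Measurability is therefore proved
  from formulas valid for all arguments, and bounds on amplitudes are required only almost
  everywhere.\<close>

lemma sum_div_mod:
  fixes f :: "nat \<Rightarrow> nat \<Rightarrow> 'a::comm_monoid_add"
  assumes "0 < b"
  shows "(\<Sum>k<a * b. f (k div b) (k mod b)) = (\<Sum>i<a. \<Sum>j<b. f i j)"
proof -
  have bound: "i * b + j < a * b" if "i < a" "j < b" for i j :: nat
  proof -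
    have "i * b + j < Suc i * b" using that by simp
    also have "\<dots> \<le> a * b" using that by (intro mult_le_mono1) simp
    finally show ?thesis .
  qed
  have "(\<Sum>k<a * b. f (k div b) (k mod b)) = (\<Sum>(i, j)\<in>{..<a} \<times> {..<b}. f i j)"
  proof (rule sum.reindex_bij_witness[where j = "\<lambda>k. (k div b, k mod b)" and i = "\<lambda>(i, j). i * b + j"])
    fix p assume "p \<in> {..<a} \<times> {..<b}"
    then show "(case p of (i, j) \<Rightarrow> i * b + j) \<in> {..<a * b}"
      using bound[of "fst p" "snd p"] by (simp add: case_prod_beta mem_Times_iff)
  qed (use assms in \<open>auto simp: less_mult_imp_div_less\<close>)
  then show ?thesis by (simp add: sum.cartesian_product)
qed

lemma mat_adjoint_dim [simp]: "dim_row (mat_adjoint A) = dim_col A" "dim_col (mat_adjoint A) = dim_row A"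
  by (simp_all add: mat_adjoint_def)

lemma mat_adjoint_index [simp]:
  fixes A :: "complex mat"
  shows "i < dim_col A \<Longrightarrow> j < dim_row A \<Longrightarrow> mat_adjoint A $$ (i, j) = cnj (A $$ (j, i))"
  by (simp add: mat_adjoint_def mat_of_rows_def)

lemma mat_mult_index:
  "i < dim_row A \<Longrightarrow> j < dim_col B \<Longrightarrow> dim_col A = dim_row B \<Longrightarrow>
    (A * B) $$ (i, j) = (\<Sum>k<dim_row B. A $$ (i, k) * B $$ (k, j))"
  by (simp add: scalar_prod_def atLeast0LessThan)

lemma kronecker_dim [simp]: "dim_row (kronecker A B) = dim_row A * dim_row B"
    "dim_col (kronecker A B) = dim_col A * dim_col B"
  by (simp_all add: kronecker_def)

lemma div_mod_less:
  fixes i a b :: nat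
  assumes "i < a * b"
  shows "i div b < a" "i mod b < b"
proof -
  have "0 < b" using assms by (cases b) auto
  then show "i div b < a" "i mod b < b" using assms by (simp_all add: less_mult_imp_div_less)
qed

text \<open>Row indices split into quotient and remainder, so each entry of the Gram matrix
  factorises into an entry for \<open>A\<close> times an entry for \<open>B\<close>. Two indices
  agree exactly when both their quotients and their remainders do.\<close>

lemma kronecker_unitary:
  assumes A: "A \<in> carrier_mat m m" "mat_adjoint A * A = 1\<^sub>m m"
    and B: "B \<in> carrier_mat n n" "mat_adjoint B * B = 1\<^sub>m n"
  shows "mat_adjoint (kronecker A B) * kronecker A B = 1\<^sub>m (m * n)"
proof (rule eq_matI)
  fix i j assume "i < dim_row (1\<^sub>m (m * n) :: complex mat)" "j < dim_col (1\<^sub>m (m * n) :: complex mat)"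
  then have ij: "i < m * n" "j < m * n" by auto
  note dm = div_mod_less[OF ij(1)] div_mod_less[OF ij(2)]
  have dims: "dim_row A = m" "dim_col A = m" "dim_row B = n" "dim_col B = n" using A B by auto
  have "0 < n" using ij by (auto intro: gr0I)
  have A1: "(\<Sum>k<m. cnj (A $$ (k, i)) * A $$ (k, j)) = (if i = j then 1 else 0)" if "i < m" "j < m" for i j
    using arg_cong[OF A(2), of "\<lambda>M. M $$ (i, j)"] that dims by (simp add: mat_mult_index del: index_mult_mat)
  have B1: "(\<Sum>k<n. cnj (B $$ (k, i)) * B $$ (k, j)) = (if i = j then 1 else 0)" if "i < n" "j < n" for i j
    using arg_cong[OF B(2), of "\<lambda>M. M $$ (i, j)"] that dims by (simp add: mat_mult_index del: index_mult_mat)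
  have "(mat_adjoint (kronecker A B) * kronecker A B) $$ (i, j) =
      (\<Sum>k<m * n. cnj (kronecker A B $$ (k, i)) * kronecker A B $$ (k, j))"
    using ij dims by (simp add: mat_mult_index del: index_mult_mat)
  also have "\<dots> = (\<Sum>k<m * n. (cnj (A $$ (k div n, i div n)) * A $$ (k div n, j div n)) *
      (cnj (B $$ (k mod n, i mod n)) * B $$ (k mod n, j mod n)))"
    using ij dims by (intro sum.cong) (auto simp: kronecker_def mult_ac)
  also have "\<dots> = (\<Sum>k<m. \<Sum>l<n. (cnj (A $$ (k, i div n)) * A $$ (k, j div n)) *
      (cnj (B $$ (l, i mod n)) * B $$ (l, j mod n)))"
    by (rule sum_div_mod[OF \<open>0 < n\<close>])
  also have "\<dots> = (\<Sum>k<m. cnj (A $$ (k, i div n)) * A $$ (k, j div n)) *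
      (\<Sum>l<n. cnj (B $$ (l, i mod n)) * B $$ (l, j mod n))"
    by (simp add: sum_product)
  also have "\<dots> = (if i = j then 1 else 0)"
    using dm by (simp add: A1 B1) (metis div_mult_mod_eq)
  also have "\<dots> = 1\<^sub>m (m * n) $$ (i, j)" using ij by simp
  finally show "(mat_adjoint (kronecker A B) * kronecker A B) $$ (i, j) = 1\<^sub>m (m * n) $$ (i, j)" .
qed (use A B in auto)

lemma pauli_mat_carrier: "pauli_mat s \<in> carrier_mat 2 2"
  by (cases s) (auto simp: mat_of_rows_list_def)

lemma pauli_mat_unitary: "mat_adjoint (pauli_mat s) * pauli_mat s = 1\<^sub>m 2"
proof -
  have d: "dim_row (pauli_mat s) = 2" "dim_col (pauli_mat s) = 2" using pauli_mat_carrier[of s] by auto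
  show ?thesis
  proof (rule eq_matI)
    fix i j assume "i < dim_row (1\<^sub>m 2 :: complex mat)" "j < dim_col (1\<^sub>m 2 :: complex mat)"
    then have ij: "i \<in> {0, 1}" "j \<in> {0, 1}" by auto
    have "(mat_adjoint (pauli_mat s) * pauli_mat s) $$ (i, j) =
        (\<Sum>k<2. cnj (pauli_mat s $$ (k, i)) * pauli_mat s $$ (k, j))"
      using ij d by (subst mat_mult_index) (auto)
    also have "\<dots> = 1\<^sub>m 2 $$ (i, j)"
      using ij by (cases s) (auto simp: mat_of_rows_list_def numeral_2_eq_2)
    finally show "(mat_adjoint (pauli_mat s) * pauli_mat s) $$ (i, j) = 1\<^sub>m 2 $$ (i, j)" .
  qed (use d in auto)
qed

lemma pauli_string_unitary:
  "pauli_string ps \<in> carrier_mat (2 ^ length ps) (2 ^ length ps) \<and>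
   mat_adjoint (pauli_string ps) * pauli_string ps = 1\<^sub>m (2 ^ length ps)"
proof (induction ps)
  case Nil
  have "mat_adjoint (1\<^sub>m 1) * (1\<^sub>m 1 :: complex mat) = 1\<^sub>m 1"
    by (rule eq_matI) (simp_all add: mat_mult_index del: index_mult_mat)
  then show ?case by (simp add: pauli_string_def)
next
  case (Cons s ps)
  have *: "pauli_string (s # ps) = kronecker (pauli_mat s) (pauli_string ps)"
    by (simp add: pauli_string_def)
  let ?K = "kronecker (pauli_mat s) (pauli_string ps)"
  have "dim_row ?K = 2 ^ length (s # ps)" "dim_col ?K = 2 ^ length (s # ps)"
    using conjunct1[OF Cons] pauli_mat_carrier[of s] by auto
  then have "?K \<in> carrier_mat (2 ^ length (s # ps)) (2 ^ length (s # ps))"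
    by (rule carrier_matI)
  moreover have "mat_adjoint ?K * ?K = 1\<^sub>m (2 ^ length (s # ps))"
    using kronecker_unitary[OF pauli_mat_carrier pauli_mat_unitary
        conjunct1[OF Cons] conjunct2[OF Cons], of s] by (simp only: length_Cons power_Suc)
  ultimately show ?case unfolding * by (rule conjI)
qed

lemma signed_pauli_string_unitary:
  assumes "signed_pauli_string n P"
  shows "P \<in> carrier_mat (2 ^ n) (2 ^ n)" "mat_adjoint P * P = 1\<^sub>m (2 ^ n)"
proof -
  obtain ps where ps: "length ps = n" "P = pauli_string ps \<or> P = - pauli_string ps"
    using assms by (auto simp: signed_pauli_string_def)
  have Q: "pauli_string ps \<in> carrier_mat (2 ^ n) (2 ^ n)"
      "mat_adjoint (pauli_string ps) * pauli_string ps = 1\<^sub>m (2 ^ n)"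
    using pauli_string_unitary[of ps] unfolding ps(1) by blast+
  show "P \<in> carrier_mat (2 ^ n) (2 ^ n)" using ps(2) Q(1) by (elim disjE) simp_all
  have "mat_adjoint (- pauli_string ps) * - pauli_string ps = mat_adjoint (pauli_string ps) * pauli_string ps"
    using Q(1) by (intro eq_matI) (auto simp: mat_mult_index sum_negf simp del: index_mult_mat(1))
  then show "mat_adjoint P * P = 1\<^sub>m (2 ^ n)"
    using ps(2) Q(2) by (elim disjE) simp_all
qed

section \<open>Inner products, unitary invariance and Cauchy-Schwarz\<close>

lemma cnj_mult_self: "cnj z * z = (complex_of_real (cmod z))\<^sup>2"
  by (subst mult.commute) (simp add: complex_norm_square[symmetric])

lemma braket_sum: "braket v w = (\<Sum>i<dim_vec v. cnj (vec_index v i) * vec_index w i)"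
  by (simp add: braket_def scalar_prod_def atLeast0LessThan mult.commute)

lemma braket_unitary:
  assumes P: "P \<in> carrier_mat d d" "mat_adjoint P * P = 1\<^sub>m d"
    and v: "v \<in> carrier_vec d"
  shows "braket (P *\<^sub>v v) (P *\<^sub>v v) = braket v v"
proof -
  have dims: "dim_row P = d" "dim_col P = d" "dim_vec v = d" using P v by auto
  have P1: "(\<Sum>k<d. cnj (P $$ (k, i)) * P $$ (k, j)) = (if i = j then 1 else 0)" if "i < d" "j < d" for i j
    using arg_cong[OF P(2), of "\<lambda>M. M $$ (i, j)"] that dims by (simp add: mat_mult_index del: index_mult_mat)
  have "braket (P *\<^sub>v v) (P *\<^sub>v v) =
      (\<Sum>k<d. (\<Sum>i<d. cnj (P $$ (k, i)) * cnj (vec_index v i)) * (\<Sum>j<d. P $$ (k, j) * vec_index v j))"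
    unfolding braket_sum using dims by (intro sum.cong) (auto simp: scalar_prod_def atLeast0LessThan)
  also have "\<dots> = (\<Sum>k<d. \<Sum>i<d. \<Sum>j<d. (cnj (vec_index v i) * vec_index v j) * (cnj (P $$ (k, i)) * P $$ (k, j)))"
    unfolding sum_product by (simp add: mult_ac)
  also have "\<dots> = (\<Sum>i<d. \<Sum>k<d. \<Sum>j<d. (cnj (vec_index v i) * vec_index v j) * (cnj (P $$ (k, i)) * P $$ (k, j)))"
    by (rule sum.swap)
  also have "\<dots> = (\<Sum>i<d. \<Sum>j<d. \<Sum>k<d. (cnj (vec_index v i) * vec_index v j) * (cnj (P $$ (k, i)) * P $$ (k, j)))"
    by (intro sum.cong refl sum.swap)
  also have "\<dots> = (\<Sum>i<d. \<Sum>j<d. (cnj (vec_index v i) * vec_index v j) * (if i = j then 1 else 0))"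
    by (simp add: P1 flip: sum_distrib_left)
  also have "\<dots> = braket v v"
    by (simp add: braket_sum dims if_distrib cong: if_cong)
  finally show ?thesis .
qed

lemma braket_self: "braket v v = complex_of_real ((L2_set (\<lambda>i. cmod (vec_index v i)) {..<dim_vec v})\<^sup>2)"
  by (simp add: braket_sum L2_set_def sum_nonneg cnj_mult_self)

lemma braket_Cauchy_Schwarz:
  assumes "dim_vec v = dim_vec w"
  shows "cmod (braket v w) \<le> sqrt (Re (braket v v)) * sqrt (Re (braket w w))"
proof -
  have "cmod (braket v w) \<le> (\<Sum>i<dim_vec v. \<bar>cmod (vec_index v i)\<bar> * \<bar>cmod (vec_index w i)\<bar>)"
    unfolding braket_sum by (rule order_trans[OF norm_sum]) (simp add: norm_mult)
  also have "\<dots> \<le> L2_set (\<lambda>i. cmod (vec_index v i)) {..<dim_vec v} * L2_set (\<lambda>i. cmod (vec_index w i)) {..<dim_vec v}"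
    by (rule L2_set_mult_ineq)
  finally show ?thesis by (simp add: braket_self assms flip: of_real_power)
qed

subsection \<open>Expansion in the eigenbasis\<close>

locale eigenbasis =
  fixes n :: nat and H :: "complex mat" and E :: "nat \<Rightarrow> real" and u :: "nat \<Rightarrow> complex vec" and N :: nat
  defines "N \<equiv> 2 ^ n"
  assumes H: "H \<in> carrier_mat N N" and eig: "eigensystem n H E u"
begin

lemma u_carrier: "i < N \<Longrightarrow> u i \<in> carrier_vec N"
  and u_dim: "i < N \<Longrightarrow> dim_vec (u i) = N"
  and u_eigen: "i < N \<Longrightarrow> H *\<^sub>v u i = complex_of_real (E i) \<cdot>\<^sub>v u i"
  and u_orth: "i < N \<Longrightarrow> k < N \<Longrightarrow> braket (u i) (u k) = (if i = k then 1 else 0)"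
  using eig by (auto simp: eigensystem_def N_def)

text \<open>A left inverse of a square matrix is also a right inverse. Applied to the matrix with
  columns \<open>u i\<close>, this turns orthonormality into the resolution of the identity.\<close>

lemma complete:
  assumes "a < N" "b < N"
  shows "(\<Sum>i<N. vec_index (u i) a * cnj (vec_index (u i) b)) = (if a = b then 1 else 0)"
proof -
  define U where "U = mat N N (\<lambda>(a, i). vec_index (u i) a)"
  have U: "U \<in> carrier_mat N N" "mat_adjoint U \<in> carrier_mat N N" by (auto simp: U_def)
  have "mat_adjoint U * U = 1\<^sub>m N"
  proof (rule eq_matI)
    fix i k assume "i < dim_row (1\<^sub>m N :: complex mat)" "k < dim_col (1\<^sub>m N :: complex mat)"
    then show "(mat_adjoint U * U) $$ (i, k) = 1\<^sub>m N $$ (i, k)"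
      using u_orth[of i k] U by (simp add: mat_mult_index braket_sum u_dim U_def del: index_mult_mat(1))
  qed (use U in auto)
  then have "U * mat_adjoint U = 1\<^sub>m N"
    using mat_mult_left_right_inverse[OF U(2,1)] by simp
  from arg_cong[OF this, of "\<lambda>M. M $$ (a, b)"] show ?thesis
    using assms U by (simp add: mat_mult_index U_def del: index_mult_mat(1))
qed

text \<open>Inverse of taking coefficients \<open>braket (u i) v\<close>. Working with coefficient
  functions reduces time evolution to multiplication by phases.\<close>

definition comb :: "(nat \<Rightarrow> complex) \<Rightarrow> complex vec" where
  "comb f = vec N (\<lambda>a. \<Sum>i<N. f i * vec_index (u i) a)"

lemma comb_dim [simp]: "dim_vec (comb f) = N" by (simp add: comb_def)
lemma comb_carrier [simp]: "comb f \<in> carrier_vec N" by (simp add: comb_def)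

lemma comb_expand:
  assumes "v \<in> carrier_vec N"
  shows "comb (\<lambda>i. braket (u i) v) = v"
proof (rule eq_vecI)
  fix a assume "a < dim_vec v"
  then have a: "a < N" using assms by auto
  have "vec_index (comb (\<lambda>i. braket (u i) v)) a =
      (\<Sum>i<N. \<Sum>b<N. vec_index v b * (vec_index (u i) a * cnj (vec_index (u i) b)))"
    using a by (simp add: comb_def braket_sum u_dim sum_distrib_left sum_distrib_right mult_ac)
  also have "\<dots> = (\<Sum>b<N. vec_index v b * (\<Sum>i<N. vec_index (u i) a * cnj (vec_index (u i) b)))"
    by (subst sum.swap) (simp add: sum_distrib_left)
  also have "\<dots> = vec_index v a" using a by (simp add: complete if_distrib cong: if_cong)
  finally show "vec_index (comb (\<lambda>i. braket (u i) v)) a = vec_index v a" .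
qed (use assms in auto)

lemma braket_comb_left:
  "braket (comb f) v = (\<Sum>i<N. cnj (f i) * braket (u i) v)"
proof -
  have "braket (comb f) v = (\<Sum>a<N. \<Sum>i<N. cnj (f i) * (cnj (vec_index (u i) a) * vec_index v a))"
    by (simp add: braket_sum comb_def sum_distrib_right mult.assoc)
  also have "\<dots> = (\<Sum>i<N. cnj (f i) * braket (u i) v)"
    by (subst sum.swap) (simp add: braket_sum u_dim sum_distrib_left)
  finally show ?thesis .
qed

lemma braket_u_comb: "i < N \<Longrightarrow> braket (u i) (comb f) = f i"
proof -
  assume i: "i < N"
  have "braket (u i) (comb f) = (\<Sum>a<N. \<Sum>k<N. f k * (cnj (vec_index (u i) a) * vec_index (u k) a))"
    using i by (simp add: braket_sum comb_def u_dim sum_distrib_left mult_ac)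
  also have "\<dots> = (\<Sum>k<N. f k * braket (u i) (u k))"
    using i by (subst sum.swap) (simp add: braket_sum u_dim sum_distrib_left)
  also have "\<dots> = f i" using i by (simp add: u_orth if_distrib cong: if_cong)
  finally show ?thesis .
qed

lemma braket_comb_comb: "braket (comb f) (comb h) = (\<Sum>i<N. cnj (f i) * h i)"
  by (simp add: braket_comb_left braket_u_comb)

lemma sum_overlaps:
  assumes "\<psi> \<in> carrier_vec N" "braket \<psi> \<psi> = 1"
  shows "(\<Sum>i<N. (cmod (braket (u i) \<psi>))\<^sup>2) = 1"
proof -
  have "complex_of_real (\<Sum>i<N. (cmod (braket (u i) \<psi>))\<^sup>2) =
      braket (comb (\<lambda>i. braket (u i) \<psi>)) (comb (\<lambda>i. braket (u i) \<psi>))"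
    by (simp add: braket_comb_comb cnj_mult_self)
  then show ?thesis using assms(2) by (simp only: comb_expand[OF assms(1)] of_real_eq_1_iff)
qed

lemma overlap_le_one:
  assumes "\<psi> \<in> carrier_vec N" "braket \<psi> \<psi> = 1" "j < N"
  shows "(cmod (braket (u j) \<psi>))\<^sup>2 \<le> 1"
  unfolding sum_overlaps[OF assms(1,2), symmetric] using assms(3)
  by (intro member_le_sum[where f = "\<lambda>i. (cmod (braket (u i) \<psi>))\<^sup>2"]) auto

lemma mult_comb:
  assumes "A \<in> carrier_mat N N"
  shows "A *\<^sub>v comb f = vec N (\<lambda>a. \<Sum>i<N. f i * vec_index (A *\<^sub>v u i) a)"
proof (rule eq_vecI)
  fix a assume "a < dim_vec (vec N (\<lambda>a. \<Sum>i<N. f i * vec_index (A *\<^sub>v u i) a))"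
  then have a: "a < N" by simp
  have "vec_index (A *\<^sub>v comb f) a = (\<Sum>b<N. \<Sum>i<N. f i * (A $$ (a, b) * vec_index (u i) b))"
    using a assms by (auto simp: scalar_prod_def comb_def atLeast0LessThan sum_distrib_left mult_ac)
  also have "\<dots> = (\<Sum>i<N. f i * vec_index (A *\<^sub>v u i) a)"
    using a assms by (subst sum.swap) (auto simp: scalar_prod_def atLeast0LessThan sum_distrib_left u_dim intro!: sum.cong)
  finally show "vec_index (A *\<^sub>v comb f) a = vec_index (vec N (\<lambda>a. \<Sum>i<N. f i * vec_index (A *\<^sub>v u i) a)) a"
    using a by simp
qed (use assms in auto)

lemma braket_mult_comb:
  assumes "A \<in> carrier_mat N N" "dim_vec v = N"
  shows "braket v (A *\<^sub>v comb f) = (\<Sum>i<N. f i * braket v (A *\<^sub>v u i))"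
proof -
  have "braket v (A *\<^sub>v comb f) = (\<Sum>a<N. \<Sum>i<N. f i * (cnj (vec_index v a) * vec_index (A *\<^sub>v u i) a))"
    using assms(2) by (simp add: braket_sum mult_comb[OF assms(1)] sum_distrib_left mult_ac)
  also have "\<dots> = (\<Sum>i<N. f i * braket v (A *\<^sub>v u i))"
    using assms by (subst sum.swap) (simp add: braket_sum sum_distrib_left)
  finally show ?thesis .
qed

text \<open>Inserting the resolution of the identity to the right of \<open>A\<close> gives its
  spectral decomposition entry by entry. The statement covers any operator diagonal in
  \<open>u\<close>, so that it applies to the powers of a multiple of \<open>H\<close>.\<close>

lemma spectral_index:
  assumes A: "A \<in> carrier_mat N N" and d: "\<And>i. i < N \<Longrightarrow> A *\<^sub>v u i = \<mu> i \<cdot>\<^sub>v u i"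
    and ab: "a < N" "b < N"
  shows "A $$ (a, b) = (\<Sum>i<N. \<mu> i * (vec_index (u i) a * cnj (vec_index (u i) b)))"
proof -
  have "A $$ (a, b) = (\<Sum>c<N. A $$ (a, c) * (\<Sum>i<N. vec_index (u i) c * cnj (vec_index (u i) b)))"
    using ab by (simp add: complete if_distrib cong: if_cong)
  also have "\<dots> = (\<Sum>i<N. (\<Sum>c<N. A $$ (a, c) * vec_index (u i) c) * cnj (vec_index (u i) b))"
    unfolding sum_distrib_left sum_distrib_right by (subst sum.swap) (simp add: mult_ac)
  also have "\<dots> = (\<Sum>i<N. vec_index (A *\<^sub>v u i) a * cnj (vec_index (u i) b))"
    using A ab by (auto simp: scalar_prod_def atLeast0LessThan u_dim intro!: sum.cong)
  also have "\<dots> = (\<Sum>i<N. \<mu> i * (vec_index (u i) a * cnj (vec_index (u i) b)))"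
    using ab by (auto simp: d u_dim intro!: sum.cong)
  finally show ?thesis .
qed

lemma evolution_carrier: "evolution H t \<in> carrier_mat N N"
  using H by (auto simp: evolution_def mat_exp_def)

lemma pow_eigen:
  assumes "i < N"
  shows "(z \<cdot>\<^sub>m H) ^\<^sub>m m *\<^sub>v u i = (z * complex_of_real (E i)) ^ m \<cdot>\<^sub>v u i"
proof (induction m)
  case 0
  then show ?case using assms u_carrier H by auto
next
  case (Suc m)
  let ?A = "z \<cdot>\<^sub>m H"
  have A: "?A \<in> carrier_mat N N" "?A ^\<^sub>m m \<in> carrier_mat N N" using H by (auto intro: pow_carrier_mat)
  have u: "u i \<in> carrier_vec N" using assms u_carrier by simp
  have s: "?A *\<^sub>v u i = (z * complex_of_real (E i)) \<cdot>\<^sub>v u i"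
  proof -
    have "?A *\<^sub>v u i = z \<cdot>\<^sub>v (H *\<^sub>v u i)"
      using H u by (intro eq_vecI) (auto simp: scalar_prod_def sum_distrib_left mult_ac)
    then show ?thesis by (simp add: u_eigen[OF assms] smult_smult_assoc)
  qed
  have "?A ^\<^sub>m Suc m *\<^sub>v u i = ?A ^\<^sub>m m *\<^sub>v (?A *\<^sub>v u i)"
    using assoc_mult_mat_vec[OF A(2,1) u] by simp
  also have "\<dots> = (z * complex_of_real (E i)) \<cdot>\<^sub>v (?A ^\<^sub>m m *\<^sub>v u i)"
    unfolding s by (rule mult_mat_vec[OF A(2) u])
  finally show ?case by (simp add: Suc smult_smult_assoc)
qed

text \<open>\<open>mat_exp\<close> is a power series in each entry. By \<open>spectral_index\<close>
  its terms are combinations of \<open>N\<close> scalar terms with coefficients independent of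
  \<open>m\<close>, so the matrix series reduces to \<open>N\<close> scalar exponential
  series.\<close>

lemma evolution_index:
  assumes "a < N" "b < N"
  shows "evolution H t $$ (a, b) = (\<Sum>i<N. exp (\<i> * complex_of_real (t * E i)) * (vec_index (u i) a * cnj (vec_index (u i) b)))"
proof -
  let ?A = "(\<i> * complex_of_real t) \<cdot>\<^sub>m H"
  have "((\<lambda>m. (\<i> * complex_of_real t * complex_of_real (E i)) ^ m /\<^sub>R fact m) sums
      exp (\<i> * complex_of_real t * complex_of_real (E i)))" for i
    by (rule exp_converges)
  then have "(\<lambda>m. \<Sum>i<N. (\<i> * complex_of_real t * complex_of_real (E i)) ^ m /\<^sub>R fact m * (vec_index (u i) a * cnj (vec_index (u i) b)))
    sums (\<Sum>i<N. exp (\<i> * complex_of_real t * complex_of_real (E i)) * (vec_index (u i) a * cnj (vec_index (u i) b)))"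
    by (intro sums_sum sums_mult2)
  moreover have "(?A ^\<^sub>m m) $$ (a, b) / fact m =
      (\<Sum>i<N. (\<i> * complex_of_real t * complex_of_real (E i)) ^ m /\<^sub>R fact m * (vec_index (u i) a * cnj (vec_index (u i) b)))" for m
  proof -
    have "(?A ^\<^sub>m m) $$ (a, b) =
      (\<Sum>i<N. (\<i> * complex_of_real t * complex_of_real (E i)) ^ m * (vec_index (u i) a * cnj (vec_index (u i) b)))"
      by (rule spectral_index[OF _ pow_eigen assms]) (use H in \<open>auto intro: pow_carrier_mat\<close>)
    then show ?thesis by (simp add: sum_divide_distrib scaleR_conv_of_real field_simps)
  qed
  ultimately show ?thesis
    using assms H by (auto simp: evolution_def mat_exp_def sums_iff mult.assoc)
qed

lemma evolution_comb: "evolution H t *\<^sub>v comb f = comb (\<lambda>i. exp (\<i> * complex_of_real (t * E i)) * f i)"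
proof (rule eq_vecI)
  fix a assume "a < dim_vec (comb (\<lambda>i. exp (\<i> * complex_of_real (t * E i)) * f i))"
  then have a: "a < N" by simp
  have "vec_index (evolution H t *\<^sub>v comb f) a = (\<Sum>b<N. \<Sum>i<N.
      exp (\<i> * complex_of_real (t * E i)) * vec_index (u i) a * (cnj (vec_index (u i) b) * vec_index (comb f) b))"
    using a evolution_carrier[of t]
    by (auto simp: scalar_prod_def atLeast0LessThan evolution_index sum_distrib_left sum_distrib_right mult_ac intro!: sum.cong)
  also have "\<dots> = (\<Sum>i<N. exp (\<i> * complex_of_real (t * E i)) * vec_index (u i) a * braket (u i) (comb f))"
    by (subst sum.swap) (simp add: braket_sum u_dim sum_distrib_left)
  also have "\<dots> = vec_index (comb (\<lambda>i. exp (\<i> * complex_of_real (t * E i)) * f i)) a"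
    using a by (simp add: braket_u_comb) (simp add: comb_def mult_ac)
  finally show "vec_index (evolution H t *\<^sub>v comb f) a = vec_index (comb (\<lambda>i. exp (\<i> * complex_of_real (t * E i)) * f i)) a" .
qed (use evolution_carrier[of t] in auto)

lemma expectation_evolution:
  "expectation_val (comb c) (evolution H t) = (\<Sum>i<N. complex_of_real ((cmod (c i))\<^sup>2) * exp (\<i> * complex_of_real (t * E i)))"
  unfolding of_real_power cnj_mult_self[symmetric] expectation_val_def evolution_comb braket_comb_comb
  by (simp only: mult_ac)

text \<open>The left evolution acts on the bra, where conjugation turns time \<open>- s\<close> into
  \<open>s\<close>. Both arguments of the resulting sesquilinear form are then evolved coefficients
  of the same shape.\<close>

lemma expectation_conjugated:
  assumes A: "A \<in> carrier_mat N N"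
  shows "expectation_val (comb c) (evolution H (- s) * A * evolution H t) =
    (\<Sum>k<N. \<Sum>i<N. cnj (exp (\<i> * complex_of_real (s * E k)) * c k) *
      (exp (\<i> * complex_of_real (t * E i)) * c i) * braket (u k) (A *\<^sub>v u i))"
proof -
  let ?v = "A *\<^sub>v comb (\<lambda>i. exp (\<i> * complex_of_real (t * E i)) * c i)"
  have v: "?v \<in> carrier_vec N" using A by auto
  have "evolution H (- s) * A * evolution H t *\<^sub>v comb c = evolution H (- s) *\<^sub>v ?v"
    using A evolution_carrier[of t] evolution_carrier[of "- s"]
    by (simp add: assoc_mult_mat_vec[where n\<^sub>3 = N and n\<^sub>2 = N and n\<^sub>1 = N] evolution_comb)
  also have "\<dots> = evolution H (- s) *\<^sub>v comb (\<lambda>k. braket (u k) ?v)"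
    by (simp only: comb_expand[OF v])
  finally have "expectation_val (comb c) (evolution H (- s) * A * evolution H t) =
      (\<Sum>k<N. cnj (c k) * (exp (\<i> * complex_of_real (- s * E k)) * braket (u k) ?v))"
    by (simp add: expectation_val_def evolution_comb braket_comb_comb)
  then show ?thesis
    by (simp add: braket_mult_comb[OF A u_dim] sum_distrib_left exp_cnj mult_ac)
qed

definition matrix_element :: "complex mat \<Rightarrow> nat \<Rightarrow> nat \<Rightarrow> complex" where
  "matrix_element A k i = braket (u k) (A *\<^sub>v u i)"

text \<open>Cauchy-Schwarz for \<open>comb f\<close> and \<open>A *\<^sub>v comb h\<close>: a
  unitary \<open>A\<close> preserves length, and by orthonormality lengths are those of the
  coefficient vectors.\<close>

lemma matrix_element_bound:
  assumes A: "A \<in> carrier_mat N N" "mat_adjoint A * A = 1\<^sub>m N"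
  shows "cmod (\<Sum>k<N. \<Sum>i<N. cnj (f k) * h i * matrix_element A k i) \<le>
    L2_set (\<lambda>i. cmod (f i)) {..<N} * L2_set (\<lambda>i. cmod (h i)) {..<N}"
proof -
  have n: "sqrt (Re (braket (comb f) (comb f))) = L2_set (\<lambda>i. cmod (f i)) {..<N}" for f
    unfolding braket_comb_comb cnj_mult_self L2_set_def of_real_power[symmetric] of_real_sum[symmetric] by simp
  have "(\<Sum>k<N. \<Sum>i<N. cnj (f k) * h i * matrix_element A k i) = braket (comb f) (A *\<^sub>v comb h)"
    by (simp add: braket_comb_left braket_mult_comb[OF A(1) u_dim] matrix_element_def sum_distrib_left mult_ac)
  also have "cmod \<dots> \<le> sqrt (Re (braket (comb f) (comb f))) * sqrt (Re (braket (A *\<^sub>v comb h) (A *\<^sub>v comb h)))"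
    using A by (intro braket_Cauchy_Schwarz) auto
  finally show ?thesis by (simp add: braket_unitary[OF A comb_carrier] n)
qed

end

text \<open>The estimators produce real numbers only; since the target is real, estimating the real
  part loses nothing.\<close>

lemma expectation_hermitian_real:
  assumes A: "A \<in> carrier_mat d d" "hermitian_mat A" and v: "v \<in> carrier_vec d"
  shows "Im (expectation_val v A) = 0"
proof -
  have A1: "cnj (A $$ (b, a)) = A $$ (a, b)" if "a < d" "b < d" for a b
    using A that unfolding hermitian_mat_def by (metis mat_adjoint_index carrier_matD)
  have e: "expectation_val v A = (\<Sum>a<d. \<Sum>b<d. cnj (vec_index v a) * (A $$ (a, b) * vec_index v b))"
    using A v by (auto simp: expectation_val_def braket_sum scalar_prod_def atLeast0LessThan sum_distrib_left intro!: sum.cong)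
  have "cnj (expectation_val v A) = (\<Sum>a<d. \<Sum>b<d. cnj (vec_index v b) * (A $$ (b, a) * vec_index v a))"
    unfolding e by (auto simp: A1 mult_ac intro!: sum.cong)
  also have "\<dots> = expectation_val v A" unfolding e by (rule sum.swap)
  finally show ?thesis by (metis Reals_cnj_iff complex_is_Real_iff)
qed

lemma expectation_pauli_sum:
  assumes P: "\<And>l. l < L \<Longrightarrow> P l \<in> carrier_mat (2 ^ n) (2 ^ n)" and v: "v \<in> carrier_vec (2 ^ n)"
  shows "expectation_val v (pauli_sum n L c P) = (\<Sum>l<L. complex_of_real (c l) * expectation_val v (P l))"
proof -
  let ?d = "2 ^ n :: nat"
  have d: "dim_vec v = ?d" using v by simp
  have Pd: "dim_row (P l) = ?d" "dim_col (P l) = ?d" if "l < L" for l using P[OF that] by auto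
  have "expectation_val v (pauli_sum n L c P) =
      (\<Sum>a<?d. \<Sum>b<?d. \<Sum>l<L. complex_of_real (c l) * (cnj (vec_index v a) * (P l $$ (a, b) * vec_index v b)))"
    by (simp add: expectation_val_def pauli_sum_def braket_sum d scalar_prod_def atLeast0LessThan
        sum_distrib_left sum_distrib_right mult_ac)
  also have "\<dots> = (\<Sum>a<?d. \<Sum>l<L. \<Sum>b<?d. complex_of_real (c l) * (cnj (vec_index v a) * (P l $$ (a, b) * vec_index v b)))"
    by (intro sum.cong refl sum.swap)
  also have "\<dots> = (\<Sum>l<L. \<Sum>a<?d. \<Sum>b<?d. complex_of_real (c l) * (cnj (vec_index v a) * (P l $$ (a, b) * vec_index v b)))"
    by (rule sum.swap)
  also have "\<dots> = (\<Sum>l<L. complex_of_real (c l) * expectation_val v (P l))"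
    by (intro sum.cong) (simp_all add: expectation_val_def braket_sum d Pd scalar_prod_def atLeast0LessThan
        sum_distrib_left)
  finally show ?thesis .
qed

subsection \<open>Truncated Hadamard tests\<close>

text \<open>A Hadamard test depends on state and unitary only through one complex number. Isolating
  it makes measurability a question about a complex function and lets both estimators share one
  analysis.\<close>

definition hadamard_law :: "complex \<Rightarrow> (nat \<times> nat) pmf" where
  "hadamard_law w = do {
     b \<leftarrow> pmf_of_set {0, 1};
     a_is_0 \<leftarrow> bernoulli_pmf ((1 + (if b = 0 then Re w else Im w)) / 2);
     return_pmf (b, if a_is_0 then 0 else 1)
   }"

lemma hadamard_test_eq: "hadamard_test \<psi> U = hadamard_law (expectation_val \<psi> U)"
  by (simp add: hadamard_test_def hadamard_law_def)

text \<open>\<open>bernoulli_pmf\<close> clamps its parameter to the unit interval. The sampling kernels have to be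
  measurable everywhere, also where the parameter of the Hadamard test is not a probability.\<close>

definition clamped :: "real \<Rightarrow> real" where
  "clamped q = min 1 (max 0 q)"

lemma clamped_measurable [measurable]: "clamped \<in> borel_measurable borel"
  unfolding clamped_def by measurable

lemma bernoulli_pmf_clamped: "bernoulli_pmf (clamped q) = bernoulli_pmf q"
  by (rule pmf_eqI) (simp add: bernoulli_pmf.rep_eq clamped_def)

text \<open>Only four outcomes occur, which leaves an explicit expression valid for every
  \<open>w\<close>. This form serves measurability; the unclamped one for
  \<open>cmod w \<le> 1\<close> serves the means.\<close>

lemma integral_hadamard_law_clamped:
  fixes F :: "nat \<times> nat \<Rightarrow> real"
  shows "(LINT r|hadamard_law w. F r) =
    (F (0, 0) * clamped ((1 + Re w) / 2) + F (0, 1) * (1 - clamped ((1 + Re w) / 2)) +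
     F (1, 0) * clamped ((1 + Im w) / 2) + F (1, 1) * (1 - clamped ((1 + Im w) / 2))) / 2"
proof -
  define q where "q = (\<lambda>b::nat. clamped ((1 + (if b = 0 then Re w else Im w)) / 2))"
  have q: "0 \<le> q b" "q b \<le> 1" for b by (auto simp: q_def clamped_def)
  define h where "h = (\<lambda>b::nat. map_pmf (\<lambda>x. (b, if x then 0 else 1::nat)) (bernoulli_pmf (q b)))"
  have law: "hadamard_law w = pmf_of_set {0, 1} \<bind> h"
    by (simp add: hadamard_law_def h_def q_def map_pmf_def bernoulli_pmf_clamped)
  have h: "(LINT r|h b. F r) = F (b, 0) * q b + F (b, 1) * (1 - q b)" for b
    using q[of b] by (simp add: h_def)
  have "(LINT r|hadamard_law w. F r) = (\<Sum>b\<in>{0,1}. (LINT r|h b. F r) /\<^sub>R real (card {0,1::nat}))"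
    unfolding law by (rule pmf_expectation_bind_pmf_of_set) (auto simp: h_def)
  then show ?thesis by (simp add: h q_def field_simps)
qed

lemma integral_hadamard_law:
  fixes F :: "nat \<times> nat \<Rightarrow> real"
  assumes "cmod w \<le> 1"
  shows "(LINT r|hadamard_law w. F r) =
    (F (0, 0) * (1 + Re w) + F (0, 1) * (1 - Re w) +
     F (1, 0) * (1 + Im w) + F (1, 1) * (1 - Im w)) / 4"
proof -
  have "\<bar>Re w\<bar> \<le> 1" "\<bar>Im w\<bar> \<le> 1"
    using assms abs_Re_le_cmod[of w] abs_Im_le_cmod[of w] by linarith+
  then have *: "clamped ((1 + Re w) / 2) = (1 + Re w) / 2" "clamped ((1 + Im w) / 2) = (1 + Im w) / 2"
    by (auto simp: clamped_def)
  show ?thesis unfolding integral_hadamard_law_clamped * by (simp add: field_simps)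
qed

text \<open>Common shape of both samples: a point of \<open>M\<close> carries the random times (and
  the term index), \<open>w\<close> is the tested amplitude, \<open>v\<close> the compensating phase
  with the known energy, \<open>C\<close> the scale, 1 or \<open>one_norm L c\<close>. The bound on
  \<open>w\<close> holds only almost everywhere because of the term indices outside the
  observable.\<close>

locale truncated_hadamard_sample = prob_space +
  fixes bad :: "'a \<Rightarrow> bool" and w v :: "'a \<Rightarrow> complex" and C :: real
  assumes bad_meas [measurable]: "Measurable.pred M bad"
    and w_meas [measurable]: "w \<in> borel_measurable M"
    and v_meas [measurable]: "v \<in> borel_measurable M"
    and w_le: "AE z in M. cmod (w z) \<le> 1"
    and v_eq: "\<And>z. z \<in> space M \<Longrightarrow> cmod (v z) = 1"
    and C_pos: "0 < C"
begin

definition outcome :: "'a \<Rightarrow> nat \<times> nat \<Rightarrow> real" where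
  "outcome z = (\<lambda>(b, a). Re (2 * complex_of_real C * \<i> ^ b * (- 1) ^ a * v z))"

definition kernel :: "'a \<Rightarrow> real measure" where
  "kernel z = (if bad z then return borel 0
     else distr (measure_pmf (hadamard_law (w z))) borel (outcome z))"

definition law :: "real measure" where
  "law = M \<bind> kernel"

lemma outcome_bound: "z \<in> space M \<Longrightarrow> \<bar>outcome z r\<bar> \<le> 2 * C"
proof -
  assume z: "z \<in> space M"
  obtain b a where r: "r = (b, a)" by force
  have "\<bar>outcome z r\<bar> \<le> cmod (2 * complex_of_real C * \<i> ^ b * (- 1) ^ a * v z)"
    unfolding outcome_def r prod.case by (rule abs_Re_le_cmod)
  also have "\<dots> = 2 * C"
    using C_pos v_eq[OF z] by (simp add: norm_mult norm_power)
  finally show ?thesis .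
qed

lemma prob_space_kernel: "prob_space (kernel z)"
  by (auto simp: kernel_def prob_space_return intro!: measure_pmf.prob_space_distr)

text \<open>The mass that the kernel gives to a set is a combination of four indicator values with
  clamped weights, and each of these is measurable in \<open>z\<close>.\<close>

lemma measurable_kernel [measurable]: "kernel \<in> measurable M (subprob_algebra borel)"
proof (rule measurable_subprob_algebra)
  show "subprob_space (kernel z)" for z
    using prob_space_kernel by (rule prob_space_imp_subprob_space)
  show "sets (kernel z) = sets borel" for z by (simp add: kernel_def)
next
  fix A :: "real set" assume A [measurable]: "A \<in> sets borel"
  define G where "G = (\<lambda>z r. indicator A (outcome z r) :: real)"
  have G [measurable]: "(\<lambda>z. G z (b, a)) \<in> borel_measurable M" for a b
    unfolding G_def outcome_def prod.case by measurable
  have E: "emeasure (kernel z) A = (if bad z then indicator A 0 else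
      ennreal ((G z (0, 0) * clamped ((1 + Re (w z)) / 2) + G z (0, 1) * (1 - clamped ((1 + Re (w z)) / 2)) +
     G z (1, 0) * clamped ((1 + Im (w z)) / 2) + G z (1, 1) * (1 - clamped ((1 + Im (w z)) / 2))) / 2))" for z
  proof -
    have "emeasure (distr (measure_pmf (hadamard_law (w z))) borel (outcome z)) A =
        ennreal (measure (measure_pmf (hadamard_law (w z))) (outcome z -` A))"
      by (subst emeasure_distr) (auto simp: measure_pmf.emeasure_eq_measure)
    also have "measure (measure_pmf (hadamard_law (w z))) (outcome z -` A) =
        (LINT r|hadamard_law (w z). G z r)"
      by (simp add: G_def indicator_vimage[symmetric, unfolded comp_def])
    finally show ?thesis
      by (simp add: kernel_def integral_hadamard_law_clamped)
  qed
  have "(\<lambda>z. if bad z then indicator A 0 else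
      ennreal ((G z (0, 0) * clamped ((1 + Re (w z)) / 2) + G z (0, 1) * (1 - clamped ((1 + Re (w z)) / 2)) +
     G z (1, 0) * clamped ((1 + Im (w z)) / 2) + G z (1, 1) * (1 - clamped ((1 + Im (w z)) / 2))) / 2)) \<in> borel_measurable M"
    by measurable
  then show "(\<lambda>z. emeasure (kernel z) A) \<in> borel_measurable M"
    unfolding E .
qed

lemma sets_law [simp, measurable_cong]: "sets law = sets borel"
  unfolding law_def by (rule sets_bind) (auto simp: kernel_def not_empty)

lemma prob_space_law: "prob_space law"
  unfolding law_def using prob_space_kernel by (intro prob_space_bind[where S = borel]) auto

lemma AE_law: "AE x in law. x \<in> {- (2 * C)..2 * C}"
  unfolding law_def
proof (subst AE_bind[where B = borel])
  show "AE z in M. AE x in kernel z. x \<in> {- (2 * C)..2 * C}"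
  proof (rule AE_I2)
    fix z assume z: "z \<in> space M"
    show "AE x in kernel z. x \<in> {- (2 * C)..2 * C}"
    proof (cases "bad z")
      case True
      have "AE x in return borel 0. x \<in> {- (2 * C)..2 * C}"
        using C_pos by (subst AE_return) auto
      moreover have "kernel z = return borel 0" using True by (simp add: kernel_def)
      ultimately show ?thesis by (simp only:)
    next
      case False
      have "\<bar>outcome z r\<bar> \<le> 2 * C" for r using outcome_bound[OF z] .
      then have "AE x in distr (measure_pmf (hadamard_law (w z))) borel (outcome z). x \<in> {- (2 * C)..2 * C}"
        by (subst AE_distr_iff) (auto simp: abs_le_iff minus_le_iff)
      moreover have "kernel z = distr (measure_pmf (hadamard_law (w z))) borel (outcome z)"
        using False by (simp add: kernel_def)
      ultimately show ?thesis by (simp only:)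
    qed
  qed
qed (measurable)

text \<open>The test with \<open>b = 0\<close> contributes \<open>Re w * Re v\<close> and the one
  with \<open>b = 1\<close> contributes \<open>- Im w * Im v\<close>, since \<open>\<i>\<close>
  rotates \<open>v\<close>; together they form \<open>Re (w * v)\<close>. The factor 2 in the
  outcome undoes the fair choice of \<open>b\<close>.\<close>

lemma integral_law:
  "(LINT x|law. x) = C * (LINT z|M. (if bad z then 0 else Re (w z * v z)))"
proof -
  \<comment> \<open>Integration against a bind asks for an integrand bounded everywhere, while the
    identity is bounded only on the support. Clipping changes no outcome that can occur.\<close>
  define clip :: "real \<Rightarrow> real" where "clip = (\<lambda>x. max (- (2 * C)) (min (2 * C) x))"
  have [measurable]: "clip \<in> borel_measurable borel" unfolding clip_def by measurable
  have "(LINT x|law. x) = (LINT x|law. clip x)"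
  proof (rule integral_cong_AE)
    show "AE x in law. x = clip x"
      using AE_law by eventually_elim (auto simp: clip_def)
  qed measurable
  also have "\<dots> = (LINT z|M. LINT x|kernel z. clip x)"
    unfolding law_def
  proof (rule integral_bind[where K = borel and B = "2 * C" and B' = 1])
    show "AE z in M. emeasure (kernel z) (space (kernel z)) \<le> ennreal 1"
      using prob_space.emeasure_space_1[OF prob_space_kernel] by simp
    show "finite_measure M" by unfold_locales
    show "\<bar>clip x\<bar> \<le> 2 * C" for x using C_pos by (auto simp: clip_def)
  qed measurable
  also have "\<dots> = (LINT z|M. C * (if bad z then 0 else Re (w z * v z)))"
  proof (rule integral_cong_AE)
    show "(\<lambda>z. LINT x|kernel z. clip x) \<in> borel_measurable M"
      by (rule measurable_compose[OF measurable_kernel integral_measurable_subprob_algebra]) measurable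
    show "AE z in M. (LINT x|kernel z. clip x) = C * (if bad z then 0 else Re (w z * v z))"
      using w_le
    proof (rule AE_mp, intro AE_I2 impI)
    fix z assume z: "z \<in> space M" and le: "cmod (w z) \<le> 1"
    show "(LINT x|kernel z. clip x) = C * (if bad z then 0 else Re (w z * v z))"
    proof (cases "bad z")
      case True then show ?thesis using C_pos by (simp add: kernel_def integral_return clip_def)
    next
      case False
      have "clip (outcome z r) = outcome z r" for r
        using outcome_bound[OF z, of r] by (auto simp: clip_def)
      then have "(LINT x|kernel z. clip x) = (LINT r|hadamard_law (w z). outcome z r)"
        using False by (simp add: kernel_def integral_distr)
      also have "\<dots> = C * Re (w z * v z)"
        by (simp add: integral_hadamard_law[OF le] outcome_def field_simps)
      finally show ?thesis using False by simp
    qed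
    qed
  qed measurable
  finally show ?thesis by simp
qed

end

subsection \<open>Concentration and Gaussian integrals\<close>

lemma average_concentration:
  fixes S :: "real measure"
  assumes "prob_space S" and sets [simp, measurable_cong]: "sets S = sets borel"
    and AE: "AE x in S. x \<in> {a..b}" and "a < b" "0 < m" "0 \<le> t"
  defines "R \<equiv> \<Pi>\<^sub>M k\<in>{..<m}. S"
  shows "measure R {z \<in> space R. \<bar>average m z - (LINT x|S. x)\<bar> \<ge> t}
    \<le> 2 * exp (- 2 * real m * t\<^sup>2 / (b - a)\<^sup>2)"
proof -
  interpret S: prob_space S by fact
  interpret R: product_prob_space "\<lambda>_. S" "{..<m}" by unfold_locales
  have comp: "distr R S (\<lambda>z. z k) = S" if "k \<in> {..<m}" for k
    unfolding R_def using that by (intro R.PiM_component)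
  have ind: "prob_space.indep_vars R (\<lambda>_. borel) (\<lambda>k z. z k) {..<m}"
  proof -
    have "prob_space.indep_vars R (\<lambda>_. S) (\<lambda>k z. z k) {..<m}"
    proof (subst prob_space.indep_vars_iff_distr_eq_PiM')
      show "prob_space R" unfolding R_def by (rule R.prob_space_axioms)
      show "{..<m} \<noteq> {}" using \<open>0 < m\<close> by auto
      show "(\<lambda>z. z k) \<in> measurable R S" if "k \<in> {..<m}" for k
        using that unfolding R_def by measurable
      \<comment> \<open>Points of the product space are extensional, so restricting to
        \<open>{..<m}\<close> is the identity there. The joint law of the coordinates is thus the
        product measure itself, which is independence.\<close>
      have "distr R (Pi\<^sub>M {..<m} (\<lambda>_. S)) (\<lambda>x. \<lambda>i\<in>{..<m}. x i) = distr R R (\<lambda>x. x)"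
        by (rule distr_cong) (auto simp: R_def space_PiM)
      also have "\<dots> = R" by (rule distr_id)
      also have "\<dots> = Pi\<^sub>M {..<m} (\<lambda>i. distr R S (\<lambda>x. x i))"
        unfolding R_def by (rule PiM_cong) (use comp in \<open>auto simp: R_def\<close>)
      finally show "distr R (Pi\<^sub>M {..<m} (\<lambda>_. S)) (\<lambda>x. \<lambda>i\<in>{..<m}. x i) =
        Pi\<^sub>M {..<m} (\<lambda>i. distr R S (\<lambda>x. x i))" .
    qed
    then show ?thesis
      unfolding prob_space.indep_vars_def2[OF R.prob_space_axioms[folded R_def]]
      by (simp cong: measurable_cong_sets)
  qed
  interpret H: Hoeffding_ineq R "{..<m}" "\<lambda>k z. z k" "\<lambda>_. a" "\<lambda>_. b" "real m * (LINT x|S. x)"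
  proof (intro Hoeffding_ineq.intro indep_interval_bounded_random_variables.intro
      indep_interval_bounded_random_variables_axioms.intro)
    show "prob_space R" unfolding R_def by (rule R.prob_space_axioms)
    show "AE x in R. x k \<in> {a..b}" if "k \<in> {..<m}" for k
      unfolding R_def using R.AE_component[OF that AE] .
    have "(LINT z|R. z k) = (LINT x|S. x)" if "k \<in> {..<m}" for k
    proof -
      have "(LINT x|distr R S (\<lambda>z. z k). x) = (LINT z|R. z k)"
        using that unfolding R_def by (intro integral_distr) auto
      then show ?thesis using comp[OF that] by simp
    qed
    then show "real m * (LINT x|S. x) \<equiv> \<Sum>i<m. LINT z|R. z i" by simp
  qed (use ind in auto)
  have "{z \<in> space R. \<bar>average m z - (LINT x|S. x)\<bar> \<ge> t} =
      {z \<in> space R. \<bar>(\<Sum>k<m. z k) - real m * (LINT x|S. x)\<bar> \<ge> real m * t}"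
  proof -
    have "(\<bar>average m z - (LINT x|S. x)\<bar> \<ge> t) = (\<bar>(\<Sum>k<m. z k) - real m * (LINT x|S. x)\<bar> \<ge> real m * t)" for z
    proof -
      have "(\<Sum>k<m. z k) - real m * (LINT x|S. x) = real m * (average m z - (LINT x|S. x))"
        using \<open>0 < m\<close> by (simp add: average_def field_simps)
      then show ?thesis using \<open>0 < m\<close> by (simp add: abs_mult)
    qed
    then show ?thesis by simp
  qed
  also have "measure R \<dots> \<le> 2 * exp (- 2 * (real m * t)\<^sup>2 / (\<Sum>i<m. (b - a)\<^sup>2))"
    using assms by (intro H.Hoeffding_ineq_abs_ge) auto
  also have "- 2 * (real m * t)\<^sup>2 / (\<Sum>i<m. (b - a)\<^sup>2) = - 2 * real m * t\<^sup>2 / (b - a)\<^sup>2"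
    using \<open>0 < m\<close> by (simp add: power2_eq_square)
  finally show ?thesis .
qed

section \<open>Normal densities, their tails and characteristic functions\<close>

lemma sampling_density_normal: "sampling_density gaussian_cooling = normal_density 0 (sqrt 2)"
proof
  fix x :: real
  have "sqrt (4 * pi) = 2 * sqrt pi" by (simp add: real_sqrt_mult)
  moreover have "sqrt pi / (2 * pi) = 1 / (2 * sqrt pi)"
    by (simp add: field_simps)
  ultimately show "sampling_density gaussian_cooling x = normal_density 0 (sqrt 2) x"
    by (simp add: sampling_density_gaussian_cooling normal_density_def field_simps)
qed

text \<open>The sampling density is even, so its autocorrelation is its convolution with itself, and
  the variances 2 + 2 add up to 4.\<close>

lemma autocorrelation_density_normal:
  "autocorrelation_density gaussian_cooling = normal_density 0 2"
proof
  fix y :: real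
  have "autocorrelation_density gaussian_cooling y =
      (LINT t|lborel. normal_density 0 (sqrt 2) (y - t) * normal_density 0 (sqrt 2) t)"
    unfolding autocorrelation_density_def sampling_density_normal
    by (simp add: normal_density_def power2_commute)
  also have "\<dots> = enn2real (\<integral>\<^sup>+t. ennreal (normal_density 0 (sqrt 2) (y - t) * normal_density 0 (sqrt 2) t) \<partial>lborel)"
    by (rule integral_eq_nn_integral) auto
  also have "\<dots> = enn2real (ennreal (normal_density 0 (sqrt ((sqrt 2)\<^sup>2 + (sqrt 2)\<^sup>2)) y))"
    using conv_normal_density_zero_mean[of "sqrt 2" "sqrt 2", THEN fun_cong, of y] by simp
  also have "\<dots> = normal_density 0 2 y" by simp
  finally show "autocorrelation_density gaussian_cooling y = normal_density 0 2 y" .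
qed

abbreviation normal_measure :: "real \<Rightarrow> real measure" where
  "normal_measure \<sigma> \<equiv> density lborel (\<lambda>x. ennreal (normal_density 0 \<sigma> x))"

text \<open>For \<open>x > a\<close> one has
  \<open>x\<^sup>2 \<ge> a\<^sup>2 + (x - a)\<^sup>2\<close>, so the density is at most
  \<open>exp (- a\<^sup>2 / (2 * \<sigma>\<^sup>2))\<close> times the density centred at
  \<open>a\<close>; symmetrically with \<open>- a\<close> on the left. Each shifted density has
  total mass 1, whence the factor 2.\<close>

lemma normal_measure_tail:
  assumes "0 < \<sigma>" "0 \<le> a"
  shows "measure (normal_measure \<sigma>) {x. \<bar>x\<bar> > a} \<le> 2 * exp (- a\<^sup>2 / (2 * \<sigma>\<^sup>2))"
proof -
  interpret prob_space "normal_measure \<sigma>" using prob_space_normal_density[OF \<open>0 < \<sigma>\<close>] .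
  let ?c = "exp (- a\<^sup>2 / (2 * \<sigma>\<^sup>2))"
  have point: "indicator {x. \<bar>x\<bar> > a} x * normal_density 0 \<sigma> x
      \<le> ?c * (normal_density a \<sigma> x + normal_density (- a) \<sigma> x)" for x
  proof -
    have shift: "normal_density 0 \<sigma> x \<le> ?c * normal_density m \<sigma> x" if "x\<^sup>2 \<ge> a\<^sup>2 + (x - m)\<^sup>2" for m
    proof -
      have "- x\<^sup>2 / (2 * \<sigma>\<^sup>2) \<le> - a\<^sup>2 / (2 * \<sigma>\<^sup>2) + - (x - m)\<^sup>2 / (2 * \<sigma>\<^sup>2)"
        using that \<open>0 < \<sigma>\<close> by (simp add: divide_simps)
      then have "exp (- x\<^sup>2 / (2 * \<sigma>\<^sup>2)) \<le> ?c * exp (- (x - m)\<^sup>2 / (2 * \<sigma>\<^sup>2))"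
        by (simp add: mult_exp_exp)
      then have "1 / sqrt (2 * pi * \<sigma>\<^sup>2) * exp (- x\<^sup>2 / (2 * \<sigma>\<^sup>2))
          \<le> 1 / sqrt (2 * pi * \<sigma>\<^sup>2) * (?c * exp (- (x - m)\<^sup>2 / (2 * \<sigma>\<^sup>2)))"
        by (rule mult_left_mono) simp
      then show ?thesis by (simp add: normal_density_def mult_ac)
    qed
    have nn: "?c * normal_density a \<sigma> x \<ge> 0" "?c * normal_density (- a) \<sigma> x \<ge> 0" by simp_all
    consider "x > a" | "x < - a" | "\<bar>x\<bar> \<le> a" by linarith
    then show ?thesis
    proof cases
      case 1
      then have "a * a \<le> a * x" using \<open>0 \<le> a\<close> by (intro mult_left_mono) auto
      then have "normal_density 0 \<sigma> x \<le> ?c * normal_density a \<sigma> x"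
        by (intro shift) (simp add: power2_eq_square algebra_simps)
      then show ?thesis using nn 1 by (simp add: distrib_left add_increasing2)
    next
      case 2
      then have "a * a \<le> a * - x" using \<open>0 \<le> a\<close> by (intro mult_left_mono) auto
      then have "normal_density 0 \<sigma> x \<le> ?c * normal_density (- a) \<sigma> x"
        by (intro shift) (simp add: power2_eq_square algebra_simps)
      then show ?thesis using nn 2 by (simp add: distrib_left add_increasing)
    next
      case 3
      then have "indicator {x. \<bar>x\<bar> > a} x = (0::real)" by auto
      then show ?thesis using nn by (simp add: distrib_left)
    qed
  qed
  have "measure (normal_measure \<sigma>) {x. \<bar>x\<bar> > a} =
      (LINT x|normal_measure \<sigma>. indicator {x. \<bar>x\<bar> > a} x)"
    by simp
  also have "\<dots> = (LINT x|lborel. indicator {x. \<bar>x\<bar> > a} x * normal_density 0 \<sigma> x)"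
    by (subst integral_density) (auto simp: mult.commute)
  also have "\<dots> \<le> (LINT x|lborel. ?c * (normal_density a \<sigma> x + normal_density (- a) \<sigma> x))"
  proof (rule integral_mono)
    show "integrable lborel (\<lambda>x. indicator {x. \<bar>x\<bar> > a} x * normal_density 0 \<sigma> x)"
      using integrable_mult_indicator[of "{x. \<bar>x\<bar> > a}" lborel "normal_density 0 \<sigma>"]
        integrable_normal_density[OF \<open>0 < \<sigma>\<close>] by simp
  qed (use point \<open>0 < \<sigma>\<close> in auto)
  also have "\<dots> = 2 * ?c"
    using \<open>0 < \<sigma>\<close> by (simp add: integral_normal_density)
  finally show ?thesis .
qed

text \<open>Rescaling reduces this to the standard normal law. For \<sigma> = sqrt 2 the value is
  the cooling function at \<open>t\<close>; for \<sigma> = 2 it is its square.\<close>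

lemma normal_measure_char:
  assumes "0 < \<sigma>"
  shows "(LINT x|normal_measure \<sigma>. exp (\<i> * complex_of_real (x * t))) =
    complex_of_real (exp (- (\<sigma> * t)\<^sup>2 / 2))"
proof -
  have "(LINT x|normal_measure \<sigma>. exp (\<i> * complex_of_real (x * t))) =
      (LINT x|lborel. normal_density 0 \<sigma> x *\<^sub>R exp (\<i> * complex_of_real (x * t)))"
    by (subst integral_density) auto
  also have "\<dots> = \<sigma> *\<^sub>R (LINT x|lborel. normal_density 0 \<sigma> (\<sigma> * x) *\<^sub>R
        exp (\<i> * complex_of_real (\<sigma> * x * t)))"
    using lborel_integral_real_affine[of \<sigma>
        "\<lambda>x. normal_density 0 \<sigma> x *\<^sub>R exp (\<i> * complex_of_real (x * t))" 0] assms
    by simp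
  also have "(\<lambda>x. normal_density 0 \<sigma> (\<sigma> * x) *\<^sub>R exp (\<i> * complex_of_real (\<sigma> * x * t))) =
      (\<lambda>x. (1 / \<sigma>) *\<^sub>R (std_normal_density x *\<^sub>R exp (\<i> * complex_of_real (\<sigma> * t * x))))"
    using assms by (auto simp: normal_density_def power_mult_distrib real_sqrt_mult mult_ac)
  also have "\<sigma> *\<^sub>R (LINT x|lborel. (1 / \<sigma>) *\<^sub>R (std_normal_density x *\<^sub>R exp (\<i> * complex_of_real (\<sigma> * t * x)))) =
      (LINT x|lborel. std_normal_density x *\<^sub>R exp (\<i> * complex_of_real (\<sigma> * t * x)))"
    using assms by (subst integral_scaleR_right) simp_all
  also have "\<dots> = char std_normal_distribution (\<sigma> * t)"
    unfolding char_def by (subst integral_density) auto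
  finally show ?thesis by (simp add: char_std_normal_distribution)
qed

text \<open>The integrands differ only on the bad event, and there by at most 1.\<close>

lemma integral_truncated:
  fixes f :: "'a \<Rightarrow> real"
  assumes "prob_space M" and [measurable]: "Measurable.pred M bad" "f \<in> borel_measurable M"
    and le: "AE z in M. \<bar>f z\<bar> \<le> 1"
  shows "\<bar>(LINT z|M. (if bad z then 0 else f z)) - (LINT z|M. f z)\<bar> \<le> measure M {z \<in> space M. bad z}"
proof -
  interpret prob_space M by fact
  have int: "integrable M f"
    by (rule integrable_const_bound[where B = 1]) (use le in auto)
  have int': "integrable M (\<lambda>z. if bad z then 0 else f z)"
    by (rule integrable_const_bound[where B = 1]) (use le in auto)
  have "\<bar>(LINT z|M. (if bad z then 0 else f z)) - (LINT z|M. f z)\<bar> =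
      norm (LINT z|M. (if bad z then 0 else f z) - f z)"
    by (simp add: Bochner_Integration.integral_diff[OF int' int])
  also have "\<dots> \<le> (LINT z|M. indicator {z \<in> space M. bad z} z)"
  proof (rule order_trans[OF integral_norm_bound], rule integral_mono_AE)
    show "integrable M (\<lambda>z. norm ((if bad z then 0 else f z) - f z))"
      using int' int by (intro integrable_norm Bochner_Integration.integrable_diff)
    show "AE z in M. norm ((if bad z then 0 else f z) - f z) \<le> indicator {z \<in> space M. bad z} z"
      using le by (rule AE_mp, intro AE_I2 impI) (simp add: indicator_def)
  qed (simp add: integrable_indicator_iff emeasure_eq_measure)
  finally show ?thesis by simp
qed

lemma integral_pair_mult:
  fixes f :: "'a \<Rightarrow> complex" and g :: "'b \<Rightarrow> complex"
  assumes "prob_space M1" "prob_space M2"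
    and [measurable]: "f \<in> borel_measurable M1" "g \<in> borel_measurable M2"
    and le: "\<And>x. cmod (f x) \<le> A" "\<And>y. cmod (g y) \<le> B"
  shows "integrable (M1 \<Otimes>\<^sub>M M2) (\<lambda>z. f (fst z) * g (snd z))"
    and "(LINT z|(M1 \<Otimes>\<^sub>M M2). f (fst z) * g (snd z)) = (LINT x|M1. f x) * (LINT y|M2. g y)"
proof -
  interpret M1: prob_space M1 by fact
  interpret M2: prob_space M2 by fact
  interpret pair_prob_space M1 M2 by unfold_locales
  show int: "integrable (M1 \<Otimes>\<^sub>M M2) (\<lambda>z. f (fst z) * g (snd z))"
  proof (rule P.integrable_const_bound[where B = "A * B"])
    have "cmod (f x) * cmod (g y) \<le> A * B" for x y
      using le by (intro mult_mono') auto
    then show "AE z in M1 \<Otimes>\<^sub>M M2. cmod (f (fst z) * g (snd z)) \<le> A * B"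
      by (simp add: norm_mult)
  qed measurable
  have "(LINT z|(M1 \<Otimes>\<^sub>M M2). f (fst z) * g (snd z)) = (LINT x|M1. LINT y|M2. f x * g y)"
    using integral_fst'[OF int] by simp
  then show "(LINT z|(M1 \<Otimes>\<^sub>M M2). f (fst z) * g (snd z)) = (LINT x|M1. f x) * (LINT y|M2. g y)"
    by simp
qed

subsection \<open>Sesquilinear forms on concentrated vectors\<close>

definition sesq :: "nat \<Rightarrow> (nat \<Rightarrow> nat \<Rightarrow> complex) \<Rightarrow> (nat \<Rightarrow> complex) \<Rightarrow> (nat \<Rightarrow> complex) \<Rightarrow> complex" where
  "sesq N b f h = (\<Sum>k<N. \<Sum>i<N. cnj (f k) * h i * b k i)"

text \<open>The matrix \<open>b\<close> has operator norm at most 1. Unlike unitarity, this survives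
  convex combinations of Pauli strings.\<close>

definition contraction :: "nat \<Rightarrow> (nat \<Rightarrow> nat \<Rightarrow> complex) \<Rightarrow> bool" where
  "contraction N b \<longleftrightarrow> (\<forall>f h. cmod (sesq N b f h) \<le>
    L2_set (\<lambda>i. cmod (f i)) {..<N} * L2_set (\<lambda>i. cmod (h i)) {..<N})"

lemma sesq_single:
  assumes "j < N"
  shows "sesq N b (\<lambda>i. if i = j then x else 0) (\<lambda>i. if i = j then y else 0) = cnj x * y * b j j"
proof -
  have "sesq N b (\<lambda>i. if i = j then x else 0) (\<lambda>i. if i = j then y else 0) =
      (\<Sum>k<N. if k = j then (\<Sum>i<N. if i = j then cnj x * y * b j j else 0) else 0)"
    unfolding sesq_def
  proof (intro sum.cong refl)
    fix k
    have "(\<Sum>i<N. cnj (if k = j then x else 0) * (if i = j then y else 0) * b k i) =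
        (\<Sum>i<N. if k = j then (if i = j then cnj x * y * b j j else 0) else 0)"
      by (intro sum.cong) auto
    also have "\<dots> = (if k = j then (\<Sum>i<N. if i = j then cnj x * y * b j j else 0) else 0)"
      by (cases "k = j") (simp_all only: simp_thms if_True if_False sum.neutral_const)
    finally show "(\<Sum>i<N. cnj (if k = j then x else 0) * (if i = j then y else 0) * b k i) =
        (if k = j then (\<Sum>i<N. if i = j then cnj x * y * b j j else 0) else 0)" .
  qed
  then show ?thesis using assms by (simp add: sum.delta)
qed

lemma L2_set_single:
  fixes j N :: nat
  assumes "j < N"
  shows "L2_set (\<lambda>i. cmod (if i = j then x else 0)) {..<N} = cmod x"
proof -
  have "(\<Sum>i<N. (cmod (if i = j then x else 0))\<^sup>2) = (\<Sum>i<N. if i = j then (cmod x)\<^sup>2 else 0)"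
    by (intro sum.cong) auto
  then show ?thesis using assms by (simp add: L2_set_def sum.delta)
qed

lemma contraction_diag:
  assumes "contraction N b" "j < N"
  shows "cmod (b j j) \<le> 1"
proof -
  have "cmod (sesq N b (\<lambda>i. if i = j then 1 else 0) (\<lambda>i. if i = j then 1 else 0)) \<le> 1 * 1"
    using assms(1)[unfolded contraction_def, rule_format,
        of "\<lambda>i. if i = j then 1 else 0" "\<lambda>i. if i = j then 1 else 0"]
    by (simp only: L2_set_single[OF assms(2)] norm_one)
  then show ?thesis by (simp only: sesq_single[OF assms(2)]) simp
qed

text \<open>Split the vector into its \<open>j\<close> component \<open>e\<close> and the rest
  \<open>r\<close>. The two cross terms are at most \<open>sqrt (p * \<rho>)\<close> each and the
  \<open>r\<close> term at most \<rho>. Another \<rho> pays for comparing with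
  \<open>p + \<rho>\<close>, the squared norm that the denominator estimates.\<close>

lemma contraction_concentrated:
  fixes \<phi> :: "nat \<Rightarrow> complex"
  assumes b: "contraction N b" and j: "j < N"
  defines "p \<equiv> (cmod (\<phi> j))\<^sup>2" and "\<rho> \<equiv> (\<Sum>i\<in>{..<N} - {j}. (cmod (\<phi> i))\<^sup>2)"
  shows "cmod (sesq N b \<phi> \<phi> - complex_of_real (p + \<rho>) * b j j) \<le> 2 * sqrt (p * \<rho>) + 2 * \<rho>"
proof -
  define e where "e = (\<lambda>i. if i = j then \<phi> j else 0)"
  define r where "r = (\<lambda>i. if i = j then 0 else \<phi> i)"
  have \<rho>: "0 \<le> \<rho>" unfolding \<rho>_def by (simp add: sum_nonneg)
  have "\<phi> = (\<lambda>i. e i + r i)" by (auto simp: e_def r_def)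
  then have "sesq N b \<phi> \<phi> = sesq N b (\<lambda>i. e i + r i) (\<lambda>i. e i + r i)" by simp
  also have "\<dots> = sesq N b e e + sesq N b e r + sesq N b r e + sesq N b r r"
    by (simp add: sesq_def sum.distrib algebra_simps)
  also have "sesq N b e e = p * b j j"
    unfolding e_def sesq_single[OF j] cnj_mult_self p_def by simp
  finally have split: "sesq N b \<phi> \<phi> - complex_of_real (p + \<rho>) * b j j =
      sesq N b e r + sesq N b r e + sesq N b r r - complex_of_real \<rho> * b j j"
    by (simp add: algebra_simps)
  have Le: "L2_set (\<lambda>i. cmod (e i)) {..<N} = sqrt p"
    unfolding e_def L2_set_single[OF j] by (simp add: p_def)
  have Lr: "L2_set (\<lambda>i. cmod (r i)) {..<N} = sqrt \<rho>"
  proof -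
    have "(\<Sum>i<N. (cmod (r i))\<^sup>2) = (\<Sum>i\<in>{..<N} - {j}. (cmod (\<phi> i))\<^sup>2)"
      by (rule sum.mono_neutral_cong_right) (auto simp: r_def)
    then show ?thesis by (simp add: L2_set_def \<rho>_def)
  qed
  note bd = b[unfolded contraction_def, rule_format]
  have "cmod (sesq N b e r) \<le> sqrt (p * \<rho>)" "cmod (sesq N b r e) \<le> sqrt (p * \<rho>)"
      "cmod (sesq N b r r) \<le> \<rho>"
    using bd[of e r] bd[of r e] bd[of r r] \<rho> unfolding Le Lr
    by (simp_all add: real_sqrt_mult mult.commute)
  moreover have "cmod (complex_of_real \<rho> * b j j) \<le> \<rho>"
    using contraction_diag[OF b j] \<rho> by (simp add: norm_mult mult_left_le)
  ultimately show ?thesis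
    unfolding split
    using norm_triangle_ineq4[of "sesq N b e r + sesq N b r e + sesq N b r r" "complex_of_real \<rho> * b j j"]
      norm_triangle_ineq[of "sesq N b e r + sesq N b r e" "sesq N b r r"]
      norm_triangle_ineq[of "sesq N b e r" "sesq N b r e"]
    by linarith
qed

text \<open>The triangle inequality. Divided by its one-norm, the observable is a convex combination
  of signed Pauli strings, which puts it under this lemma.\<close>

lemma contraction_convex:
  assumes b: "\<And>l. l < L \<Longrightarrow> contraction N (b l)" and w: "\<And>l. l < L \<Longrightarrow> 0 \<le> w l" "(\<Sum>l<L. w l) = (1::real)"
  shows "contraction N (\<lambda>k i. \<Sum>l<L. complex_of_real (w l) * b l k i)"
  unfolding contraction_def
proof (intro allI)
  fix f h :: "nat \<Rightarrow> complex"
  let ?X = "L2_set (\<lambda>i. cmod (f i)) {..<N} * L2_set (\<lambda>i. cmod (h i)) {..<N}"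
  have "sesq N (\<lambda>k i. \<Sum>l<L. complex_of_real (w l) * b l k i) f h =
      (\<Sum>k<N. \<Sum>i<N. \<Sum>l<L. complex_of_real (w l) * (cnj (f k) * h i * b l k i))"
    by (simp add: sesq_def sum_distrib_left mult_ac)
  also have "\<dots> = (\<Sum>k<N. \<Sum>l<L. \<Sum>i<N. complex_of_real (w l) * (cnj (f k) * h i * b l k i))"
    by (intro sum.cong refl sum.swap)
  also have "\<dots> = (\<Sum>l<L. \<Sum>k<N. \<Sum>i<N. complex_of_real (w l) * (cnj (f k) * h i * b l k i))"
    by (rule sum.swap)
  also have "\<dots> = (\<Sum>l<L. complex_of_real (w l) * sesq N (b l) f h)"
    by (simp add: sesq_def sum_distrib_left)
  also have "cmod \<dots> \<le> (\<Sum>l<L. w l * ?X)"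
  proof (rule sum_norm_le)
    fix l assume "l \<in> {..<L}"
    then have l: "l < L" by simp
    have "cmod (sesq N (b l) f h) \<le> ?X" using b[OF l] by (auto simp: contraction_def)
    then show "cmod (complex_of_real (w l) * sesq N (b l) f h) \<le> w l * ?X"
      using w(1)[OF l] by (simp add: norm_mult mult_left_mono)
  qed
  also have "\<dots> = ?X" by (simp add: w(2) flip: sum_distrib_right)
  finally show "cmod (sesq N (\<lambda>k i. \<Sum>l<L. complex_of_real (w l) * b l k i) f h) \<le> ?X" .
qed

text \<open>After multiplication by \<open>d\<close> the claim reads
  \<open>\<bar>e - S * T * d\<bar> \<le> \<epsilon> * S * d\<close>. In units of
  \<open>S * \<epsilon> * p\<close> the left side collects 1/8 from \<open>e\<close>, 5/8 from
  \<kappa> and 1/8 from replacing \<open>D\<close> by \<open>d\<close>. The sum 7/8 is covered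
  because \<open>d\<close> is at least \<open>7 / 8 * p\<close>.\<close>

lemma ratio_error:
  fixes d e D n T S \<epsilon> p \<kappa> :: real
  assumes "0 < S" "0 < \<epsilon>" "\<epsilon> < 1" "0 < p" "p \<le> D"
    and d: "\<bar>d - D\<bar> \<le> \<epsilon> * p / 8" and e: "\<bar>e - S * n\<bar> \<le> S * (\<epsilon> * p / 8)"
    and n: "\<bar>n - D * T\<bar> \<le> \<kappa>" "\<kappa> \<le> 5 / 8 * (\<epsilon> * p)" and T: "\<bar>T\<bar> \<le> 1"
  shows "d \<noteq> 0" "\<bar>e / d - S * T\<bar> \<le> \<epsilon> * S"
proof -
  have "\<epsilon> * p \<le> p" using assms by (simp add: mult_left_le_one_le)
  then have dp: "7 / 8 * p \<le> d" using d assms(5) by linarith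
  then have dpos: "0 < d" using assms by linarith
  then show "d \<noteq> 0" by simp
  have "\<epsilon> * (7 / 8 * p) \<le> \<epsilon> * d" using dp assms by (intro mult_left_mono) auto
  moreover have "\<bar>T * (D - d)\<bar> \<le> \<epsilon> * p / 8"
    using mult_mono[OF T d] by (simp add: abs_mult abs_minus_commute)
  moreover have "n - T * d = (n - D * T) + T * (D - d)" by (simp add: algebra_simps)
  ultimately have "\<bar>n - T * d\<bar> + \<epsilon> * p / 8 \<le> \<epsilon> * d" using n by linarith
  then have "S * \<bar>n - T * d\<bar> + S * (\<epsilon> * p / 8) \<le> S * (\<epsilon> * d)"
    using mult_left_mono[of _ _ S] \<open>0 < S\<close> by (fastforce simp only: distrib_left[symmetric])
  moreover have "\<bar>S * (n - T * d)\<bar> = S * \<bar>n - T * d\<bar>" using \<open>0 < S\<close> by (simp add: abs_mult)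
  moreover have "\<bar>e - S * T * d\<bar> \<le> \<bar>e - S * n\<bar> + \<bar>S * (n - T * d)\<bar>"
    using abs_triangle_ineq[of "e - S * n" "S * (n - T * d)"] by (simp add: algebra_simps)
  ultimately have "\<bar>e - S * T * d\<bar> \<le> S * (\<epsilon> * d)" using e by linarith
  then have "\<bar>e - S * T * d\<bar> \<le> \<epsilon> * S * d" by (simp add: mult_ac)
  moreover have "e / d - S * T = (e - S * T * d) / d" using dpos by (simp add: field_simps)
  ultimately show "\<bar>e / d - S * T\<bar> \<le> \<epsilon> * S" using dpos by (simp add: divide_le_eq)
qed

subsection \<open>Measurability and the success probability of a run\<close>

text \<open>Reading a vector beyond its dimension gives a value that does not depend on the entries.
  Products of matrices with mismatched dimensions read such values.\<close>

lemma vec_index_ge: "n \<le> k \<Longrightarrow> vec_index (vec n f) k = undef_vec (k - n)"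
  by transfer (simp add: mk_vec_def)

text \<open>The inner dimensions \<open>ca\<close> and \<open>rb\<close> may differ, as happens for
  term indices outside the observable. The sum runs over the rows of \<open>B\<close>, and the
  missing entries of \<open>A\<close> are constants in \<open>x\<close>.\<close>

lemma borel_measurable_mat_mult:
  fixes A B :: "'a \<Rightarrow> complex mat"
  assumes A: "\<And>x. dim_row (A x) = ra" "\<And>x. dim_col (A x) = ca"
      "\<And>i k. i < ra \<Longrightarrow> k < ca \<Longrightarrow> (\<lambda>x. A x $$ (i, k)) \<in> borel_measurable M"
    and B: "\<And>x. dim_row (B x) = rb" "\<And>x. dim_col (B x) = cb"
      "\<And>k j. k < rb \<Longrightarrow> j < cb \<Longrightarrow> (\<lambda>x. B x $$ (k, j)) \<in> borel_measurable M"
    and ij: "i < ra" "j < cb"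
  shows "(\<lambda>x. (A x * B x) $$ (i, j)) \<in> borel_measurable M"
proof -
  have "(A x * B x) $$ (i, j) =
      (\<Sum>k<rb. (if k < ca then A x $$ (i, k) else undef_vec (k - ca)) * B x $$ (k, j))" for x
    using ij by (auto simp: A(1,2) B(1,2) scalar_prod_def atLeast0LessThan row_def vec_index_ge intro!: sum.cong)
  moreover have "(\<lambda>x. \<Sum>k<rb. (if k < ca then A x $$ (i, k) else undef_vec (k - ca)) * B x $$ (k, j))
      \<in> borel_measurable M"
  proof (rule borel_measurable_sum)
    fix k assume "k \<in> {..<rb}"
    then show "(\<lambda>x. (if k < ca then A x $$ (i, k) else undef_vec (k - ca)) * B x $$ (k, j)) \<in> borel_measurable M"
      using ij A(3)[of i k] B(3)[of k j] by (cases "k < ca") (auto intro: borel_measurable_times)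
  qed
  ultimately show ?thesis by simp
qed

lemma borel_measurable_expectation:
  fixes A :: "'a \<Rightarrow> complex mat"
  assumes A: "\<And>x. dim_row (A x) = d" "\<And>x. dim_col (A x) = d"
      "\<And>i k. i < d \<Longrightarrow> k < d \<Longrightarrow> (\<lambda>x. A x $$ (i, k)) \<in> borel_measurable M"
    and v: "dim_vec v = d"
  shows "(\<lambda>x. expectation_val v (A x)) \<in> borel_measurable M"
proof -
  have "expectation_val v (A x) = (\<Sum>a<d. \<Sum>b<d. cnj (vec_index v a) * (A x $$ (a, b) * vec_index v b))" for x
    by (auto simp: expectation_val_def braket_sum v A(1,2) scalar_prod_def atLeast0LessThan sum_distrib_left intro!: sum.cong)
  then show ?thesis using A(3) by (auto intro!: borel_measurable_sum borel_measurable_times)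
qed

text \<open>The term index is discrete, so joint measurability can be checked for each fixed
  \<open>l\<close>.\<close>

lemma measurable_triple_countable:
  assumes "\<And>l. (\<lambda>(x, x'). f (x, x', l)) \<in> measurable (M1 \<Otimes>\<^sub>M M2) K"
  shows "f \<in> measurable (M1 \<Otimes>\<^sub>M (M2 \<Otimes>\<^sub>M count_space (UNIV :: nat set))) K"
proof -
  have "(\<lambda>z. (\<lambda>(x, x'). f (x, x', snd (snd z))) (fst z, fst (snd z)))
      \<in> measurable (M1 \<Otimes>\<^sub>M (M2 \<Otimes>\<^sub>M count_space (UNIV :: nat set))) K"
  proof (rule measurable_compose_countable[where g = "\<lambda>z. snd (snd z)" and
        f = "\<lambda>l z. (\<lambda>(x, x'). f (x, x', l)) (fst z, fst (snd z))"])
    fix l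
    show "(\<lambda>z. (\<lambda>(x, x'). f (x, x', l)) (fst z, fst (snd z)))
        \<in> measurable (M1 \<Otimes>\<^sub>M (M2 \<Otimes>\<^sub>M count_space (UNIV :: nat set))) K"
      by (rule measurable_compose[OF _ assms]) measurable
  qed measurable
  then show ?thesis by simp
qed

text \<open>Range and tolerance of the numerator are both scaled by \<open>C\<close>, so Hoeffding
  gives the same exponent \<open>- real m * t\<^sup>2 / 8\<close> for both averages. Each leaves its
  window with probability at most \<open>\<delta> / 2\<close>; by independence both stay with
  probability at least \<open>(1 - \<delta> / 2)\<^sup>2\<close>, which exceeds
  \<open>1 - \<delta>\<close>.\<close>

lemma run_success_probability:
  assumes S1: "prob_space S1" "sets S1 = sets borel" "AE x in S1. x \<in> {- 2..2}"
    and S2: "prob_space S2" "sets S2 = sets borel" "AE x in S2. x \<in> {- (2 * C)..2 * C}"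
    and "0 < C" "0 < m" "0 \<le> t" "0 < \<delta>" "\<delta> < 1"
    and m: "2 * exp (- real m * t\<^sup>2 / 8) \<le> \<delta> / 2"
    and good: "\<And>d e. \<bar>d - (LINT x|S1. x)\<bar> < t \<Longrightarrow> \<bar>e - (LINT x|S2. x)\<bar> < C * t \<Longrightarrow>
      d \<noteq> 0 \<and> cmod (complex_of_real (e / d) - target) \<le> err"
  defines "R \<equiv> (\<Pi>\<^sub>M k\<in>{..<m}. S1) \<Otimes>\<^sub>M (\<Pi>\<^sub>M k\<in>{..<m}. S2)"
  shows "1 - \<delta> \<le> measure R {\<omega> \<in> space R. estimation_succeeds m target err \<omega>}"
proof -
  note [measurable_cong] = S1(2) S2(2)
  interpret S1: prob_space S1 by fact
  interpret S2: prob_space S2 by fact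
  let ?R1 = "\<Pi>\<^sub>M k\<in>{..<m}. S1" and ?R2 = "\<Pi>\<^sub>M k\<in>{..<m}. S2"
  interpret R1: prob_space ?R1 by (rule prob_space_PiM) unfold_locales
  interpret R2: prob_space ?R2 by (rule prob_space_PiM) unfold_locales
  interpret R: pair_prob_space ?R1 ?R2 by unfold_locales
  have avg1 [measurable]: "average m \<in> borel_measurable ?R1"
    unfolding average_def by measurable
  have avg2 [measurable]: "average m \<in> borel_measurable ?R2"
    unfolding average_def by measurable
  define B1 where "B1 = {z \<in> space ?R1. \<bar>average m z - (LINT x|S1. x)\<bar> \<ge> t}"
  define B2 where "B2 = {z \<in> space ?R2. \<bar>average m z - (LINT x|S2. x)\<bar> \<ge> C * t}"
  have [measurable]: "B1 \<in> sets ?R1" "B2 \<in> sets ?R2" unfolding B1_def B2_def by measurable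
  have "measure ?R1 B1 \<le> 2 * exp (- 2 * real m * t\<^sup>2 / (2 - - 2)\<^sup>2)"
    unfolding B1_def using assms by (intro average_concentration) auto
  also have "- 2 * real m * t\<^sup>2 / (2 - - 2)\<^sup>2 = - real m * t\<^sup>2 / 8" by (simp add: power2_eq_square)
  finally have b1: "measure ?R1 B1 \<le> \<delta> / 2" using m by simp
  have "measure ?R2 B2 \<le> 2 * exp (- 2 * real m * (C * t)\<^sup>2 / (2 * C - - (2 * C))\<^sup>2)"
    unfolding B2_def using assms by (intro average_concentration) auto
  also have "- 2 * real m * (C * t)\<^sup>2 / (2 * C - - (2 * C))\<^sup>2 = - real m * t\<^sup>2 / 8"
    using \<open>0 < C\<close> by (simp add: power2_eq_square field_simps)
  finally have b2: "measure ?R2 B2 \<le> \<delta> / 2" using m by simp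
  have succ [measurable]: "{\<omega> \<in> space R. estimation_succeeds m target err \<omega>} \<in> sets R"
    unfolding R_def estimation_succeeds_def case_prod_beta by measurable
  have "(1 - \<delta> / 2) * (1 - \<delta> / 2) \<le> measure ?R1 (space ?R1 - B1) * measure ?R2 (space ?R2 - B2)"
    using b1 b2 \<open>\<delta> < 1\<close> by (intro mult_mono) (auto simp: R1.prob_compl R2.prob_compl)
  also have "\<dots> = measure R ((space ?R1 - B1) \<times> (space ?R2 - B2))"
    unfolding R_def by (simp add: measure_def R2.emeasure_pair_measure_Times enn2real_mult)
  also have "\<dots> \<le> measure R {\<omega> \<in> space R. estimation_succeeds m target err \<omega>}"
  proof (rule R.P.finite_measure_mono[folded R_def])
    show "(space ?R1 - B1) \<times> (space ?R2 - B2) \<subseteq> {\<omega> \<in> space R. estimation_succeeds m target err \<omega>}"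
    proof
      fix \<omega> assume "\<omega> \<in> (space ?R1 - B1) \<times> (space ?R2 - B2)"
      then have "\<omega> \<in> space R" "\<bar>average m (fst \<omega>) - (LINT x|S1. x)\<bar> < t"
          "\<bar>average m (snd \<omega>) - (LINT x|S2. x)\<bar> < C * t"
        by (auto simp: R_def space_pair_measure B1_def B2_def not_le)
      then show "\<omega> \<in> {\<omega> \<in> space R. estimation_succeeds m target err \<omega>}"
        using good by (simp only: estimation_succeeds_def case_prod_beta mem_Collect_eq simp_thms)
    qed
  qed (rule succ)
  finally have "(1 - \<delta> / 2) * (1 - \<delta> / 2) \<le> measure R {\<omega> \<in> space R. estimation_succeeds m target err \<omega>}" .
  moreover have "1 - \<delta> \<le> (1 - \<delta> / 2) * (1 - \<delta> / 2)" by (simp add: algebra_simps)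
  ultimately show ?thesis by linarith
qed

subsection \<open>Means of the estimators\<close>

text \<open>Energies increase with the index, so the neighbour of \<open>j\<close> on the side of
  \<open>i\<close> has an energy between \<open>E i\<close> and \<open>E j\<close>, or equal to
  \<open>E i\<close>.\<close>

lemma spectral_gap_le:
  assumes E: "strict_mono_on {..<2 ^ n} E" and ij: "i < 2 ^ n" "j < 2 ^ n" "i \<noteq> j"
  shows "spectral_gap n E j \<le> \<bar>E i - E j\<bar>"
proof -
  let ?S = "{\<bar>E k - E j\<bar> | k. k < 2 ^ n \<and> (k + 1 = j \<or> k = j + 1)}"
  have "?S \<subseteq> (\<lambda>k. \<bar>E k - E j\<bar>) ` {..<2 ^ n}" by blast
  then have fin: "finite ?S" by (rule finite_subset) simp
  have mono: "E a \<le> E b" if "a \<le> b" "b < 2 ^ n" for a b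
    using strict_mono_on_leD[OF E, of a b] that by simp
  show ?thesis
  proof (cases "i < j")
    case True
    have "\<bar>E (j - 1) - E j\<bar> \<in> ?S" using True ij by (intro CollectI exI[of _ "j - 1"]) auto
    then have "spectral_gap n E j \<le> \<bar>E (j - 1) - E j\<bar>"
      unfolding spectral_gap_def by (rule Min_le[OF fin])
    moreover have "E i \<le> E (j - 1)" "E (j - 1) \<le> E j" using True ij by (intro mono; simp)+
    ultimately show ?thesis by linarith
  next
    case False
    have "\<bar>E (j + 1) - E j\<bar> \<in> ?S" using False ij by (intro CollectI exI[of _ "j + 1"]) auto
    then have "spectral_gap n E j \<le> \<bar>E (j + 1) - E j\<bar>"
      unfolding spectral_gap_def by (rule Min_le[OF fin])
    moreover have "E (j + 1) \<le> E i" "E j \<le> E (j + 1)" using False ij by (intro mono; simp)+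
    ultimately show ?thesis by linarith
  qed
qed

lemma spectral_gap_pos:
  assumes E: "strict_mono_on {..<2 ^ n} E" and j: "j < 2 ^ n" and "0 < n"
  shows "0 < spectral_gap n E j"
proof -
  let ?S = "{\<bar>E k - E j\<bar> | k. k < 2 ^ n \<and> (k + 1 = j \<or> k = j + 1)}"
  have "?S \<subseteq> (\<lambda>k. \<bar>E k - E j\<bar>) ` {..<2 ^ n}" by blast
  then have fin: "finite ?S" by (rule finite_subset) simp
  \<comment> \<open>With at least two levels, \<open>j\<close> has a neighbour; otherwise the gap
    would be the unspecified minimum of the empty set.\<close>
  have "(2::nat) ^ 1 \<le> 2 ^ n" using \<open>0 < n\<close> by (intro power_increasing) auto
  then have two: "(2::nat) \<le> 2 ^ n" by simp
  have ne: "?S \<noteq> {}"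
  proof (cases "j = 0")
    case True
    then have "\<bar>E 1 - E j\<bar> \<in> ?S" using two by (intro CollectI exI[of _ 1]) auto
    then show ?thesis by blast
  next
    case False
    then have "\<bar>E (j - 1) - E j\<bar> \<in> ?S" using j by (intro CollectI exI[of _ "j - 1"]) auto
    then show ?thesis by blast
  qed
  have "spectral_gap n E j \<in> ?S" unfolding spectral_gap_def by (rule Min_in[OF fin ne])
  then obtain k where k: "spectral_gap n E j = \<bar>E k - E j\<bar>" "k < 2 ^ n" "k \<noteq> j" by auto
  have "E k \<noteq> E j"
    using strict_mono_on_imp_inj_on[OF E] k j by (auto simp: inj_on_def)
  then show ?thesis using k by simp
qed

lemma term_pmf_props:
  assumes "0 < L" "\<And>l. l < L \<Longrightarrow> 0 < c l"
  shows "0 < one_norm L c" "pmf (term_pmf L c) l = (if l < L then c l / one_norm L c else 0)"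
    "(\<Sum>l<L. c l / one_norm L c) = 1"
proof -
  have s: "one_norm L c = (\<Sum>l<L. c l)"
    unfolding one_norm_def using assms by (intro sum.cong) (auto simp: less_imp_le)
  show pos: "0 < one_norm L c" unfolding s using assms by (intro sum_pos) auto
  then show sum: "(\<Sum>l<L. c l / one_norm L c) = 1"
    by (simp add: s flip: sum_divide_distrib)
  have nn: "0 \<le> c l / one_norm L c" if "l < L" for l
    using assms(2)[OF that] pos by simp
  show "pmf (term_pmf L c) l = (if l < L then c l / one_norm L c else 0)"
    unfolding term_pmf_def
  proof (rule pmf_embed_pmf)
    show "0 \<le> (if l < L then c l / one_norm L c else 0)" for l using nn by simp
    have "(\<integral>\<^sup>+ l. ennreal (if l < L then c l / one_norm L c else 0) \<partial>count_space UNIV) =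
        (\<Sum>l<L. ennreal (if l < L then c l / one_norm L c else 0))"
      by (rule nn_integral_count_space'[OF finite_lessThan]) auto
    also have "\<dots> = (\<Sum>l<L. ennreal (c l / one_norm L c))" by (intro sum.cong) auto
    also have "\<dots> = ennreal (\<Sum>l<L. c l / one_norm L c)" using nn by (intro sum_ennreal) auto
    finally show "(\<integral>\<^sup>+ l. ennreal (if l < L then c l / one_norm L c else 0) \<partial>count_space UNIV) = 1"
      by (simp add: sum)
  qed
qed

section \<open>Cooled amplitudes and the two sample means\<close>

locale cooling = eigenbasis +
  fixes j :: nat and \<psi> :: "complex vec" and \<tau> x\<^sub>m :: real
  assumes j: "j < N" and \<psi>: "\<psi> \<in> carrier_vec N" "braket \<psi> \<psi> = 1" and x\<^sub>m: "0 \<le> x\<^sub>m"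
begin

definition amp :: "nat \<Rightarrow> complex" where "amp i = braket (u i) \<psi>"

definition shift :: "nat \<Rightarrow> real" where "shift i = \<tau> * (E i - E j)"

text \<open>Coefficients of \<open>exp (- \<tau>\<^sup>2 * (H - E j)\<^sup>2)\<close> applied to
  \<psi>, not normalised.\<close>

definition cooled :: "nat \<Rightarrow> complex" where "cooled i = complex_of_real (exp (- (shift i)\<^sup>2)) * amp i"

lemma \<psi>_comb: "comb amp = \<psi>"
  unfolding amp_def by (rule comb_expand[OF \<psi>(1)])

lemma amp_norm: "(\<Sum>i<N. (cmod (amp i))\<^sup>2) = 1"
  unfolding amp_def using \<psi> by (rule sum_overlaps)

lemma phase: "exp (\<i> * complex_of_real (\<tau> * x * E i)) * exp (- \<i> * complex_of_real (\<tau> * x * E j)) =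
    exp (\<i> * complex_of_real (x * shift i))"
  by (simp add: mult_exp_exp shift_def algebra_simps)

lemma cmod_phase [simp]: "cmod (exp (\<i> * complex_of_real t)) = 1"
  by simp

lemma cmod_phase_neg [simp]: "cmod (exp (- \<i> * complex_of_real t)) = 1"
  using cmod_phase[of "- t"] by simp

text \<open>Test amplitude and compensating phase combine to a mixture of phases
  \<open>y * shift i\<close> with weights \<open>(cmod (amp i))\<^sup>2\<close>. The time has
  variance 4, so averaging yields the square of the cooling factor: one random time gives the
  squared norm of the cooled vector. Cutting off the time costs one Gaussian tail.\<close>

lemma denominator:
  defines "S \<equiv> denominator_sample gaussian_cooling \<tau> x\<^sub>m H (E j) \<psi>"
  shows "prob_space S" "sets S = sets borel" "AE x in S. x \<in> {- 2..2}"
    "\<bar>(LINT x|S. x) - (\<Sum>i<N. (cmod (cooled i))\<^sup>2)\<bar> \<le> 2 * exp (- x\<^sub>m\<^sup>2 / 8)"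
proof -
  interpret G: prob_space "normal_measure 2" by (rule prob_space_normal_density) simp
  define w where "w = (\<lambda>y. \<Sum>i<N. complex_of_real ((cmod (amp i))\<^sup>2) * exp (\<i> * complex_of_real (\<tau> * y * E i)))"
  define v where "v = (\<lambda>y. exp (- \<i> * complex_of_real (\<tau> * y * E j)))"
  have w_eq: "expectation_val \<psi> (evolution H (\<tau> * y)) = w y" for y
    unfolding w_def using expectation_evolution[of amp "\<tau> * y"] by (simp only: \<psi>_comb)
  have w_le: "cmod (w y) \<le> 1" for y
  proof -
    have "cmod (w y) \<le> (\<Sum>i<N. (cmod (amp i))\<^sup>2)"
      unfolding w_def by (rule sum_norm_le) (simp add: norm_mult norm_power)
    then show ?thesis by (simp only: amp_norm)
  qed
  interpret T: truncated_hadamard_sample "normal_measure 2" "\<lambda>y. \<bar>y\<bar> > x\<^sub>m" w v 1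
  proof unfold_locales
    show "w \<in> borel_measurable (normal_measure 2)" "v \<in> borel_measurable (normal_measure 2)"
      unfolding w_def v_def by measurable
    show "Measurable.pred (normal_measure 2) (\<lambda>y. \<bar>y\<bar> > x\<^sub>m)" by measurable
    show "AE y in normal_measure 2. cmod (w y) \<le> 1" using w_le by simp
    show "cmod (v y) = 1" for y unfolding v_def by (rule cmod_phase_neg)
  qed simp
  have S: "S = T.law"
    unfolding S_def denominator_sample_def T.law_def autocorrelation_density_normal
      T.kernel_def T.outcome_def hadamard_test_eq w_eq
    unfolding v_def of_real_1 mult_1_right ..
  show "prob_space S" "sets S = sets borel" "AE x in S. x \<in> {- 2..2}"
    unfolding S using T.prob_space_law T.sets_law T.AE_law by simp_all
  have wv: "w y * v y = (\<Sum>i<N. complex_of_real ((cmod (amp i))\<^sup>2) * exp (\<i> * complex_of_real (y * shift i)))" for y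
    unfolding w_def v_def sum_distrib_right phase[symmetric] by (simp only: mult.assoc)
  have int: "integrable (normal_measure 2) (\<lambda>y. exp (\<i> * complex_of_real (y * shift i)))" for i
    by (rule G.integrable_const_bound[where B = 1]) (use cmod_phase in auto)
  have "(LINT y|normal_measure 2. w y * v y) =
      (\<Sum>i<N. complex_of_real ((cmod (amp i))\<^sup>2) * (LINT y|normal_measure 2. exp (\<i> * complex_of_real (y * shift i))))"
    unfolding wv by (subst Bochner_Integration.integral_sum) (use int in auto)
  also have "\<dots> = complex_of_real (\<Sum>i<N. (cmod (cooled i))\<^sup>2)"
  proof -
    have "(cmod (cooled i))\<^sup>2 = (cmod (amp i))\<^sup>2 * exp (- (2 * shift i)\<^sup>2 / 2)" for i
      by (simp add: cooled_def norm_mult power_mult_distrib exp_double[symmetric] mult.commute)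
    then show ?thesis by (subst normal_measure_char) simp_all
  qed
  finally have "(LINT y|normal_measure 2. Re (w y * v y)) = (\<Sum>i<N. (cmod (cooled i))\<^sup>2)"
    using int by (subst integral_Re) (simp_all add: wv)
  moreover have "\<bar>(LINT x|S. x) - (LINT y|normal_measure 2. Re (w y * v y))\<bar>
      \<le> measure (normal_measure 2) {y \<in> space (normal_measure 2). \<bar>y\<bar> > x\<^sub>m}"
    unfolding S T.integral_law mult_1
  proof (rule integral_truncated)
    have "\<bar>Re (w y * v y)\<bar> \<le> 1" for y
      using abs_Re_le_cmod[of "w y * v y"] w_le[of y] by (simp add: norm_mult T.v_eq)
    then show "AE y in normal_measure 2. \<bar>Re (w y * v y)\<bar> \<le> 1" by simp
  qed (unfold_locales, measurable)
  moreover have "measure (normal_measure 2) {y. \<bar>y\<bar> > x\<^sub>m} \<le> 2 * exp (- x\<^sub>m\<^sup>2 / 8)"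
    using normal_measure_tail[of 2 x\<^sub>m] x\<^sub>m by simp
  ultimately show "\<bar>(LINT x|S. x) - (\<Sum>i<N. (cmod (cooled i))\<^sup>2)\<bar> \<le> 2 * exp (- x\<^sub>m\<^sup>2 / 8)"
    by simp
qed

lemma evolution_index_measurable:
  assumes f: "f \<in> borel_measurable M" and ab: "a < N" "b < N"
  shows "(\<lambda>x. evolution H (f x) $$ (a, b)) \<in> borel_measurable M"
  unfolding evolution_index[OF ab] using f by measurable

lemma evolution_dim: "dim_row (evolution H t) = N" "dim_col (evolution H t) = N"
  using evolution_carrier[of t] by auto

text \<open>The term \<open>P\<close> is arbitrary here: the sampling kernel has to be measurable also on the null
  set of indices \<open>l \<ge> L\<close>, where nothing is known about \<open>P l\<close>.\<close>

lemma conjugated_measurable: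
  "(\<lambda>(x, x'). expectation_val \<psi> (evolution H (- \<tau> * x') * P * evolution H (\<tau> * x)))
    \<in> borel_measurable (borel \<Otimes>\<^sub>M borel)"
  unfolding case_prod_beta
proof (rule borel_measurable_expectation)
  show "(\<lambda>z. (evolution H (- \<tau> * snd z) * P * evolution H (\<tau> * fst z)) $$ (i, k))
      \<in> borel_measurable (borel \<Otimes>\<^sub>M borel)" if ik: "i < N" "k < N" for i k
  proof (rule borel_measurable_mat_mult[where ra = N and ca = "dim_col P" and rb = N and cb = N])
    show "(\<lambda>z. (evolution H (- \<tau> * snd z) * P) $$ (i, k)) \<in> borel_measurable (borel \<Otimes>\<^sub>M borel)"
      if "i < N" "k < dim_col P" for i k
      by (rule borel_measurable_mat_mult[where ra = N and ca = N and rb = "dim_row P" and cb = "dim_col P"])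
        (use that in \<open>auto simp: evolution_dim intro!: evolution_index_measurable\<close>)
  qed (use ik in \<open>auto simp: evolution_dim intro!: evolution_index_measurable\<close>)
qed (use \<psi>(1) in \<open>auto simp: evolution_dim\<close>)

text \<open>Two independent times cool ket and bra separately, one factor
  \<open>exp (- (shift i)\<^sup>2)\<close> each, and the random term index averages the Pauli matrix
  elements into \<open>b\<close>. For fixed eigenindices the integrand is a product of functions of
  \<open>x\<close>, \<open>x'\<close> and \<open>l\<close>, so the mean factorises.\<close>

lemma numerator:
  assumes L: "0 < L" "\<And>l. l < L \<Longrightarrow> 0 < c l"
    and P: "\<And>l. l < L \<Longrightarrow> P l \<in> carrier_mat N N \<and> mat_adjoint (P l) * P l = 1\<^sub>m N"
  defines "S \<equiv> numerator_sample gaussian_cooling \<tau> x\<^sub>m H (E j) \<psi> L c P"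
    and "b \<equiv> (\<lambda>k i. \<Sum>l<L. complex_of_real (c l / one_norm L c) * matrix_element (P l) k i)"
  shows "prob_space S" "sets S = sets borel"
    "AE x in S. x \<in> {- (2 * one_norm L c)..2 * one_norm L c}"
    "\<bar>(LINT x|S. x) - one_norm L c * Re (sesq N b cooled cooled)\<bar> \<le> one_norm L c * (4 * exp (- x\<^sub>m\<^sup>2 / 4))"
proof -
  let ?G = "normal_measure (sqrt 2)" and ?T = "measure_pmf (term_pmf L c)"
  let ?M = "?G \<Otimes>\<^sub>M (?G \<Otimes>\<^sub>M ?T)"
  let ?C = "one_norm L c"
  note tp = term_pmf_props[of L c, OF L]
  have C: "0 < ?C" using tp(1) .
  interpret G: prob_space ?G by (rule prob_space_normal_density) simp
  interpret GT: pair_prob_space ?G ?T by unfold_locales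
  interpret GGT: pair_prob_space ?G "?G \<Otimes>\<^sub>M ?T" by unfold_locales
  define w where "w = (\<lambda>(x, x', l). expectation_val \<psi> (evolution H (- \<tau> * x') * P l * evolution H (\<tau> * x)))"
  define v where "v = (\<lambda>(x, x', l::nat). exp (- \<i> * complex_of_real (\<tau> * (x - x') * E j)))"
  define bad where "bad = (\<lambda>(x, x', l::nat). \<bar>x\<bar> > x\<^sub>m \<or> \<bar>x'\<bar> > x\<^sub>m)"
  have setsM: "sets ?M = sets (borel \<Otimes>\<^sub>M (borel \<Otimes>\<^sub>M count_space UNIV))"
    by (intro sets_pair_measure_cong) auto
  have w_meas [measurable]: "w \<in> borel_measurable ?M"
    unfolding measurable_cong_sets[OF setsM refl] w_def
    by (rule measurable_triple_countable) (use conjugated_measurable in simp)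
  have v_meas [measurable]: "v \<in> borel_measurable ?M"
    unfolding measurable_cong_sets[OF setsM refl] v_def by measurable
  have bad_meas [measurable]: "Measurable.pred ?M bad"
    unfolding measurable_cong_sets[OF setsM refl] bad_def by measurable
  have AE_L: "AE z in ?M. snd (snd z) < L"
  proof -
    have "AE l in ?T. l < L"
      using tp(2) by (auto simp: AE_measure_pmf_iff set_pmf_iff split: if_splits)
    then have "AE y in ?G \<Otimes>\<^sub>M ?T. snd y < L"
      by (intro GT.AE_pair_measure) auto
    moreover have "Measurable.pred ?M (\<lambda>z. snd (snd z) < L)"
      unfolding measurable_cong_sets[OF setsM refl] by measurable
    ultimately show ?thesis
      by (intro GGT.AE_pair_measure) (simp_all only: pred_def fst_conv snd_conv, simp)
  qed
  have form: "w (x, x', l) = sesq N (matrix_element (P l)) (\<lambda>k. exp (\<i> * complex_of_real (\<tau> * x' * E k)) * amp k)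
      (\<lambda>i. exp (\<i> * complex_of_real (\<tau> * x * E i)) * amp i)" if l: "l < L" for x x' l
    using expectation_conjugated[of "P l" amp "\<tau> * x'" "\<tau> * x"] P[OF l]
    by (simp add: w_def \<psi>_comb sesq_def matrix_element_def)
  have contr: "contraction N (matrix_element (P l))" if "l < L" for l
    unfolding contraction_def sesq_def using matrix_element_bound P[OF that] by blast
  have w_le: "cmod (w z) \<le> 1" if "snd (snd z) < L" for z
  proof -
    obtain x x' l where z: "z = (x, x', l)" by (cases z)
    have l: "l < L" using that z by simp
    have one: "L2_set (\<lambda>i. cmod (exp (\<i> * complex_of_real (y * E i)) * amp i)) {..<N} = 1" for y
      unfolding norm_mult cmod_phase mult_1 L2_set_def amp_norm by simp
    show ?thesis
      using contr[OF l, unfolded contraction_def, rule_format] unfolding z form[OF l]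
      by (metis (no_types) one mult_1)
  qed
  interpret S: truncated_hadamard_sample ?M bad w v ?C
  proof unfold_locales
    show "AE z in ?M. cmod (w z) \<le> 1" using AE_L by (rule AE_mp) (use w_le in simp)
    show "cmod (v z) = 1" for z unfolding v_def case_prod_beta by (rule cmod_phase_neg)
  qed (use C in measurable)
  have S: "S = S.law"
    unfolding S_def numerator_sample_def S.law_def sampling_density_normal S.kernel_def S.outcome_def hadamard_test_eq
    by (rule arg_cong2[where f = bind, OF refl], rule ext)
      (simp only: split_paired_all bad_def w_def v_def prod.case)
  show "prob_space S" "sets S = sets borel" "AE x in S. x \<in> {- (2 * ?C)..2 * ?C}"
    unfolding S using S.prob_space_law S.sets_law S.AE_law by simp_all

  define F where "F = (\<lambda>i x. exp (\<i> * complex_of_real (x * shift i)))"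
  \<comment> \<open>The bra phase is conjugated, hence the sign of \<open>shift k\<close>; the
    Gaussian average is even and does not see it.\<close>
  define G' where "G' = (\<lambda>k x. exp (\<i> * complex_of_real (x * (- shift k))))"
  \<comment> \<open>Zero outside the observable makes the factor bounded for every \<open>l\<close>,
    which the product formula for integrals requires; those \<open>l\<close> have probability
    zero.\<close>
  define h where "h = (\<lambda>k i l. if l < L then matrix_element (P l) k i else 0)"
  have F_le: "cmod (F i x) \<le> 1" "cmod (G' i x) \<le> 1" for i x
    unfolding F_def G'_def cmod_phase by simp_all
  have Fm [measurable]: "F i \<in> borel_measurable ?G" "G' i \<in> borel_measurable ?G" for i
    unfolding F_def G'_def by measurable
  have h_le: "cmod (h k i l) \<le> (\<Sum>l<L. cmod (matrix_element (P l) k i))" for k i l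
    unfolding h_def by (auto intro!: member_le_sum sum_nonneg)
  have wv: "w (x, x', l) * v (x, x', l) =
      (\<Sum>k<N. \<Sum>i<N. cnj (amp k) * amp i * (F i x * (G' k x' * h k i l)))" if l: "l < L" for x x' l
  proof -
    define ph where "ph = (\<lambda>y. exp (\<i> * complex_of_real y))"
    have ph: "ph a * ph b = ph (a + b)" "cnj (ph a) = ph (- a)" for a b
      by (simp_all add: ph_def mult_exp_exp distrib_left exp_cnj)
    have "cnj (ph (\<tau> * x' * E k)) * ph (\<tau> * x * E i) * ph (- (\<tau> * (x - x') * E j)) =
        ph (x * shift i) * ph (x' * (- shift k))" for k i
      unfolding ph by (rule arg_cong[where f = ph]) (simp add: shift_def algebra_simps)
    then have "cnj (ph (\<tau> * x' * E k) * amp k) * (ph (\<tau> * x * E i) * amp i) * matrix_element (P l) k i *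
        ph (- (\<tau> * (x - x') * E j)) =
        cnj (amp k) * amp i * (ph (x * shift i) * (ph (x' * (- shift k)) * matrix_element (P l) k i))" for k i
      by (simp add: mult_ac)
    note eq = this
    have phe: "exp (\<i> * complex_of_real y) = ph y" for y by (simp add: ph_def)
    have v: "v (x, x', l) = ph (- (\<tau> * (x - x') * E j))" by (simp add: v_def ph_def)
    show ?thesis
      unfolding form[OF l] sesq_def v F_def G'_def h_def if_P[OF l] phe sum_distrib_right
      by (intro sum.cong refl eq)
  qed
  have inner: "integrable (?G \<Otimes>\<^sub>M ?T) (\<lambda>y. G' k (fst y) * h k i (snd y))"
    "(LINT y|(?G \<Otimes>\<^sub>M ?T). G' k (fst y) * h k i (snd y)) =
      complex_of_real (exp (- (shift k)\<^sup>2)) * b k i" for k i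
  proof -
    have T: "prob_space ?T" "h k i \<in> borel_measurable ?T"
      by (simp_all add: measure_pmf.prob_space_axioms)
    note pair = integral_pair_mult[OF G.prob_space_axioms T(1) Fm(2)[of k] T(2) F_le(2)[of k] h_le[of k i]]
    show "integrable (?G \<Otimes>\<^sub>M ?T) (\<lambda>y. G' k (fst y) * h k i (snd y))"
      by (rule pair(1))
    have "(LINT y|?G. G' k y) = complex_of_real (exp (- (shift k)\<^sup>2))"
      unfolding G'_def by (subst normal_measure_char) (simp_all add: power_mult_distrib)
    moreover have "(LINT l|?T. h k i l) = b k i"
    proof -
      have "(LINT l|?T. h k i l) = (\<Sum>l<L. pmf (term_pmf L c) l *\<^sub>R h k i l)"
        by (rule integral_measure_pmf) (auto simp: h_def split: if_splits)
      then show ?thesis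
        by (simp add: b_def h_def tp(2) scaleR_conv_of_real)
    qed
    ultimately show "(LINT y|(?G \<Otimes>\<^sub>M ?T). G' k (fst y) * h k i (snd y)) =
        complex_of_real (exp (- (shift k)\<^sup>2)) * b k i"
      using pair(2) by simp
  qed
  have outer: "integrable ?M (\<lambda>z. F i (fst z) * (G' k (fst (snd z)) * h k i (snd (snd z))))"
    "(LINT z|?M. F i (fst z) * (G' k (fst (snd z)) * h k i (snd (snd z)))) =
      complex_of_real (exp (- (shift i)\<^sup>2)) * (complex_of_real (exp (- (shift k)\<^sup>2)) * b k i)" for k i
  proof -
    have le: "cmod (G' k (fst y) * h k i (snd y)) \<le> 1 * (\<Sum>l<L. cmod (matrix_element (P l) k i))" for y
      unfolding norm_mult using F_le h_le by (intro mult_mono') auto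
    have m: "(\<lambda>y. G' k (fst y) * h k i (snd y)) \<in> borel_measurable (?G \<Otimes>\<^sub>M ?T)"
      using inner(1) by (rule borel_measurable_integrable)
    note pair = integral_pair_mult[OF G.prob_space_axioms GT.P.prob_space_axioms Fm(1)[of i] m F_le(1)[of i] le]
    show "integrable ?M (\<lambda>z. F i (fst z) * (G' k (fst (snd z)) * h k i (snd (snd z))))"
      by (rule pair(1))
    have "(LINT y|?G. F i y) = complex_of_real (exp (- (shift i)\<^sup>2))"
      unfolding F_def by (subst normal_measure_char) (simp_all add: power_mult_distrib)
    then show "(LINT z|?M. F i (fst z) * (G' k (fst (snd z)) * h k i (snd (snd z)))) =
      complex_of_real (exp (- (shift i)\<^sup>2)) * (complex_of_real (exp (- (shift k)\<^sup>2)) * b k i)"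
      using pair(2) by (simp only: inner(2))
  qed
  define wv' where "wv' = (\<lambda>z. \<Sum>k<N. \<Sum>i<N. cnj (amp k) * amp i *
      (F i (fst z) * (G' k (fst (snd z)) * h k i (snd (snd z)))))"
  have int': "integrable ?M wv'"
    unfolding wv'_def by (intro Bochner_Integration.integrable_sum integrable_mult_right outer(1))
  have AE_wv: "AE z in ?M. w z * v z = wv' z"
    using AE_L by (rule AE_mp) (auto simp: wv wv'_def)
  have "(LINT z|?M. wv' z) = (\<Sum>k<N. \<Sum>i<N. cnj (amp k) * amp i *
      (complex_of_real (exp (- (shift i)\<^sup>2)) * (complex_of_real (exp (- (shift k)\<^sup>2)) * b k i)))"
    unfolding wv'_def
    by (simp add: outer Bochner_Integration.integral_sum Bochner_Integration.integrable_sum)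
  also have "\<dots> = sesq N b cooled cooled"
    by (simp add: sesq_def cooled_def mult_ac)
  finally have mean: "(LINT z|?M. Re (wv' z)) = Re (sesq N b cooled cooled)"
    using int' by (subst integral_Re) simp_all
  have eq: "(LINT z|?M. Re (w z * v z)) = Re (sesq N b cooled cooled)"
    unfolding mean[symmetric]
  proof (rule integral_cong_AE)
    show "AE z in ?M. Re (w z * v z) = Re (wv' z)" using AE_wv by (rule AE_mp) simp
    show "(\<lambda>z. Re (wv' z)) \<in> borel_measurable ?M"
      using borel_measurable_integrable[OF int'] by measurable
  qed measurable
  have "\<bar>(LINT z|?M. (if bad z then 0 else Re (w z * v z))) - Re (sesq N b cooled cooled)\<bar>
      \<le> measure ?M {z \<in> space ?M. bad z}"
    unfolding eq[symmetric]
  proof (rule integral_truncated[OF GGT.P.prob_space_axioms bad_meas])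
    have le: "\<bar>Re (w z * v z)\<bar> \<le> 1" if "snd (snd z) < L" "z \<in> space ?M" for z
      using abs_Re_le_cmod[of "w z * v z"] w_le[OF that(1)] by (simp add: norm_mult S.v_eq[OF that(2)])
    show "AE z in ?M. \<bar>Re (w z * v z)\<bar> \<le> 1"
      using AE_L by (rule AE_mp) (intro AE_I2 impI le)
  qed measurable
  also have "\<dots> \<le> 4 * exp (- x\<^sub>m\<^sup>2 / 4)"
  proof -
    \<comment> \<open>Union bound: one Gaussian tail for each of the two times, which doubles the
      constant 2 to 4.\<close>
    let ?A = "{x :: real. \<bar>x\<bar> > x\<^sub>m}"
    let ?X = "?A \<times> space (?G \<Otimes>\<^sub>M ?T)" and ?Y = "space ?G \<times> (?A \<times> space ?T)"
    have A [measurable]: "?A \<in> sets ?G" by simp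
    have tail: "measure ?G ?A \<le> 2 * exp (- x\<^sub>m\<^sup>2 / 4)"
      using normal_measure_tail[of "sqrt 2" x\<^sub>m] x\<^sub>m by simp
    have X: "measure ?M ?X = measure ?G ?A"
      by (simp add: measure_def GT.P.emeasure_pair_measure_Times GT.P.emeasure_space_1 del: space_pair_measure)
    have Y: "measure ?M ?Y = measure ?G ?A"
    proof -
      have AT: "?A \<times> space ?T \<in> sets (?G \<Otimes>\<^sub>M ?T)" by (rule pair_measureI) simp_all
      have "emeasure ?M ?Y = emeasure ?G (space ?G) * emeasure (?G \<Otimes>\<^sub>M ?T) (?A \<times> space ?T)"
        by (rule GT.P.emeasure_pair_measure_Times[OF sets.top AT])
      also have "emeasure (?G \<Otimes>\<^sub>M ?T) (?A \<times> space ?T) = emeasure ?G ?A * emeasure ?T (space ?T)"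
        by (rule measure_pmf.emeasure_pair_measure_Times[OF A sets.top])
      finally show ?thesis
        unfolding measure_def by (simp only: G.emeasure_space_1 measure_pmf.emeasure_space_1 mult_1 mult_1_right)
    qed
    have XY: "?X \<in> sets ?M" "?Y \<in> sets ?M" by (intro pair_measureI sets.top; simp)+
    have "measure ?M {z \<in> space ?M. bad z} \<le> measure ?M (?X \<union> ?Y)"
      by (rule GGT.P.finite_measure_mono[OF _ sets.Un[OF XY]]) (auto simp: bad_def space_pair_measure)
    also have "\<dots> \<le> measure ?M ?X + measure ?M ?Y"
      by (rule measure_Un_le[OF XY])
    finally show ?thesis using X Y tail by linarith
  qed
  finally have *: "\<bar>(LINT z|?M. (if bad z then 0 else Re (w z * v z))) - Re (sesq N b cooled cooled)\<bar>
      \<le> 4 * exp (- x\<^sub>m\<^sup>2 / 4)" .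
  have "\<bar>(LINT x|S. x) - ?C * Re (sesq N b cooled cooled)\<bar> =
      ?C * \<bar>(LINT z|?M. (if bad z then 0 else Re (w z * v z))) - Re (sesq N b cooled cooled)\<bar>"
    unfolding S S.integral_law using C by (simp add: abs_mult flip: right_diff_distrib)
  then show "\<bar>(LINT x|S. x) - ?C * Re (sesq N b cooled cooled)\<bar> \<le> ?C * (4 * exp (- x\<^sub>m\<^sup>2 / 4))"
    using * C by (simp add: mult_left_mono)
qed

end

subsection \<open>Choice of the parameters\<close>

text \<open>\<open>\<rho>\<close> is the weight that cooling leaves outside the target eigenvector. For \<open>s \<le> 99/100\<close> the
  cooling makes it small, since then \<open>ln (1 / s) \<ge> 1/100\<close> and the factor \<open>2000\<close> absorbs the constant in
  \<open>ln (64 / s) = ln 64 + ln (1 / s)\<close>. For larger \<open>s\<close> the imaginary time may vanish, but then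
  the initial state already has overlap at least \<open>99/100\<close>.\<close>

lemma leakage_bound:
  fixes \<epsilon> p \<rho> :: real
  defines "s \<equiv> \<epsilon> * p"
  assumes \<epsilon>: "0 < \<epsilon>" "\<epsilon> < 1" and p: "0 < p" "p \<le> 1"
    and \<rho>: "0 \<le> \<rho>" "\<rho> \<le> exp (- 2 * (2000 * ln (1 / s) / sqrt (8 * ln (64 / s)))\<^sup>2) * (1 - p)"
  shows "2 * sqrt (p * \<rho>) + 2 * \<rho> \<le> 5 / 8 * s"
proof -
  have s: "0 < s" "s \<le> p" "s < 1"
    using \<epsilon> p by (auto simp: s_def mult_left_le_one_le mult_le_one less_le_trans intro: le_less_trans[of _ "\<epsilon> * 1"] mult_left_mono)
  define l where "l = ln (1 / s)"
  define y where "y = ln (64 / s)"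
  have l: "1 - s \<le> l" using ln_le_minus_one[OF s(1)] s by (simp add: l_def ln_div)
  have y: "y = ln 64 + l" using s by (simp add: l_def y_def ln_div)
  have "ln (64::real) = 6 * ln 2" using ln_realpow[of 2 6] by simp
  then have ln64: "0 < ln (64::real)" "ln (64::real) \<le> 6" using ln_2_less_1 by auto
  have p\<rho>: "p * \<rho> \<le> \<rho>" using p \<rho> by (simp add: mult_left_le_one_le)
  show ?thesis
  proof (cases "s \<le> 99 / 100")
    case True
    then have "1 / 100 \<le> l" using l by simp
    \<comment> \<open>Origin of 2000: \<open>3 * y \<le> 18 + 3 * l\<close>, and
      \<open>18 \<le> 1997 * l\<close> once \<open>l\<close> is at least 1/100. The inequality
      pushes the exponent to at least \<open>2 * y\<close>, so that \<rho> is at most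
      \<open>(s / 64)\<^sup>2\<close> and the whole leakage at most \<open>s / 16\<close>.\<close>
    then have "3 * y \<le> 2000 * l" "0 < y" using y ln64 by linarith+
    then have "(3 * y)\<^sup>2 \<le> (2000 * l)\<^sup>2" by (intro power_mono) auto
    then have "9 * y\<^sup>2 \<le> 4000000 * l\<^sup>2" by (simp add: power_mult_distrib)
    moreover have "0 \<le> l\<^sup>2" by simp
    ultimately have "16 * y\<^sup>2 \<le> 2 * (4000000 * l\<^sup>2)" by linarith
    then have "2 * y * (8 * y) \<le> 2 * (2000 * l)\<^sup>2"
      by (simp add: power2_eq_square)
    then have "2 * y \<le> 2 * (2000 * l)\<^sup>2 / (8 * y)" using \<open>0 < y\<close> by (subst pos_le_divide_eq) auto
    also have "\<dots> = 2 * (2000 * l / sqrt (8 * y))\<^sup>2" using \<open>0 < y\<close> by (simp add: power_divide)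
    finally have "exp (- 2 * (2000 * l / sqrt (8 * y))\<^sup>2) \<le> exp (- (2 * y))" by simp
    also have "exp (- (2 * y)) = (s / 64)\<^sup>2"
      using s by (simp add: exp_minus exp_double y_def power_divide field_simps)
    finally have "\<rho> \<le> (s / 64)\<^sup>2"
      using \<rho>(2) p mult_mono[of "exp (- 2 * (2000 * l / sqrt (8 * y))\<^sup>2)" "(s / 64)\<^sup>2" "1 - p" 1]
      by (simp add: l_def y_def)
    moreover from this have "sqrt (p * \<rho>) \<le> sqrt ((s / 64)\<^sup>2)"
      using p\<rho> by (intro real_sqrt_le_mono) linarith
    moreover have "(s / 64)\<^sup>2 \<le> s / 64"
      using s by (simp add: power2_eq_square mult_left_le_one_le)
    ultimately show ?thesis using s by simp
  next
    case False
    \<comment> \<open>Since \<open>p \<ge> s > 99 / 100\<close>, even without cooling \<rho> is at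
      most 1/100. The leakage is then at most 22/100, below the budget \<open>5 / 8 * s\<close>,
      which exceeds 61/100.\<close>
    then have "1 - p \<le> 1 / 100" using s by simp
    moreover have "\<rho> \<le> 1 * (1 - p)"
      using \<rho>(2) p by (elim order_trans) (intro mult_right_mono, auto)
    ultimately have \<rho>': "\<rho> \<le> (1 / 10)\<^sup>2" by (simp add: power2_eq_square)
    then have "sqrt (p * \<rho>) \<le> sqrt ((1 / 10)\<^sup>2)"
      using p\<rho> by (intro real_sqrt_le_mono) linarith
    also have "\<dots> = 1 / 10" by simp
    finally show ?thesis using \<rho>' False by (simp add: power2_eq_square)
  qed
qed

text \<open>The 8 under the root is twice the variance 4 of the denominator's time, so that tail is
  \<open>2 * (s / 64)\<close>. The numerator's times have variance 2 and give
  \<open>4 * (s / 64)\<^sup>2\<close>, at most \<open>4 * (s / 64)\<close>.\<close>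

lemma truncation_bound:
  fixes s :: real
  assumes "0 < s" "s < 1"
  shows "2 * exp (- (sqrt (8 * ln (64 / s)))\<^sup>2 / 8) \<le> s / 16"
    "4 * exp (- (sqrt (8 * ln (64 / s)))\<^sup>2 / 4) \<le> s / 16"
proof -
  have "0 < ln (64 / s)" using assms by simp
  then have sq: "(sqrt (8 * ln (64 / s)))\<^sup>2 = 8 * ln (64 / s)" by simp
  have e: "exp (- ln (64 / s)) = s / 64" using assms by (simp add: exp_minus)
  show "2 * exp (- (sqrt (8 * ln (64 / s)))\<^sup>2 / 8) \<le> s / 16"
    unfolding sq using e assms by simp
  have "exp (- (8 * ln (64 / s)) / 4) = (s / 64)\<^sup>2"
    unfolding e[symmetric] by (simp add: exp_double[symmetric])
  also have "\<dots> \<le> s / 64" using assms by (simp add: power2_eq_square mult_left_le_one_le)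
  finally show "4 * exp (- (sqrt (8 * ln (64 / s)))\<^sup>2 / 4) \<le> s / 16"
    unfolding sq by simp
qed

section \<open>Success of a run with the chosen parameters\<close>

lemma eigensystem_eigenbasis:
  assumes "H \<in> carrier_mat (2 ^ n) (2 ^ n)" "eigensystem n H E u"
  shows "eigenbasis n H E u"
  by unfold_locales (use assms in simp_all)

lemma cooling_success:
  fixes n H E u j \<psi> obs L c P \<epsilon> \<delta> m
  defines "p \<equiv> (cmod (braket (u j) \<psi>))\<^sup>2"
  defines "s \<equiv> \<epsilon> * p"
  defines "x\<^sub>m \<equiv> sqrt (8 * ln (64 / s))"
  defines "\<tau> \<equiv> 2000 * ln (1 / s) / (spectral_gap n E j * x\<^sub>m)"
  defines "R \<equiv> estimation_run gaussian_cooling \<tau> x\<^sub>m m H (E j) \<psi> L c P"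
  assumes "0 < n" and H: "H \<in> carrier_mat (2 ^ n) (2 ^ n)" and eig: "eigensystem n H E u" and j: "j < 2 ^ n"
    and \<psi>: "\<psi> \<in> carrier_vec (2 ^ n)" "braket \<psi> \<psi> = 1" and p: "0 < p"
    and obs: "pauli_observable n obs L c P" and \<epsilon>: "0 < \<epsilon>" "\<epsilon> < 1"
    and \<delta>: "0 < \<delta>" "\<delta> < 1" and m: "0 < m" "2048 * ln (4 / \<delta>) \<le> real m * s\<^sup>2"
  shows "1 - \<delta> \<le> measure R {\<omega> \<in> space R.
    estimation_succeeds m (expectation_val (u j) obs) (\<epsilon> * one_norm L c) \<omega>}"
proof -
  define N where "N = (2::nat) ^ n"
  define \<Delta> where "\<Delta> = spectral_gap n E j"
  interpret B: eigenbasis n H E u N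
    by unfold_locales (use H eig in \<open>simp_all only: N_def\<close>)
  note jN = j[folded N_def] and \<psi>N = \<psi>(1)[folded N_def]
  have mono: "strict_mono_on {..<2 ^ n} E" using eig by (simp add: eigensystem_def)
  have \<Delta>: "0 < \<Delta>" unfolding \<Delta>_def by (rule spectral_gap_pos[OF mono j \<open>0 < n\<close>])
  have gap: "\<Delta> \<le> \<bar>E i - E j\<bar>" if "i < N" "i \<noteq> j" for i
    unfolding \<Delta>_def using spectral_gap_le[OF mono _ j] that by (simp only: N_def)
  have p1: "p \<le> 1"
    unfolding p_def by (rule B.overlap_le_one[OF \<psi>N \<psi>(2) jN])
  have "\<epsilon> * p \<le> \<epsilon>" using \<epsilon> p1 by (simp add: mult_left_le)
  then have "s < 1" unfolding s_def using \<epsilon>(2) by (rule le_less_trans)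
  moreover have "0 < s" using \<epsilon> p by (simp add: s_def)
  ultimately have s: "0 < s" "s < 1" by blast+
  have x\<^sub>m: "0 < x\<^sub>m" using s by (simp add: x\<^sub>m_def)
  interpret cooling n H E u N j \<psi> \<tau> x\<^sub>m
    by unfold_locales (use j \<psi> x\<^sub>m in simp_all)
  have p_amp: "p = (cmod (amp j))\<^sup>2" by (simp add: p_def amp_def)

  have L: "0 < L" "\<And>l. l < L \<Longrightarrow> 0 < c l" and sp: "\<And>l. l < L \<Longrightarrow> signed_pauli_string n (P l)"
    and obs_eq: "obs = pauli_sum n L c P" and obs_h: "hermitian_mat obs"
    using obs by (auto simp: pauli_observable_def)
  have P: "P l \<in> carrier_mat N N \<and> mat_adjoint (P l) * P l = 1\<^sub>m N" if "l < L" for l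
    using signed_pauli_string_unitary[OF sp[OF that]] unfolding N_def by blast
  let ?C = "one_norm L c"
  note tp = term_pmf_props[of L c, OF L]
  have C: "0 < ?C" by (rule tp(1))
  define b where "b = (\<lambda>k i. \<Sum>l<L. complex_of_real (c l / ?C) * B.matrix_element (P l) k i)"
  have contr: "contraction N b"
    unfolding b_def
  proof (rule contraction_convex)
    show "contraction N (B.matrix_element (P l))" if "l < L" for l
      unfolding contraction_def sesq_def using B.matrix_element_bound P[OF that] by blast
    show "0 \<le> c l / ?C" if "l < L" for l using L(2)[OF that] C by simp
  qed (rule tp(3))
  have target: "expectation_val (u j) obs = complex_of_real (?C * Re (b j j))"
  proof -
    have uc: "u j \<in> carrier_vec N" using B.u_carrier jN by blast
    have "obs \<in> carrier_mat N N" unfolding obs_eq pauli_sum_def N_def by simp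
    then have "Im (expectation_val (u j) obs) = 0"
      by (rule expectation_hermitian_real[OF _ obs_h uc])
    moreover have "expectation_val (u j) obs = (\<Sum>l<L. complex_of_real (c l) * expectation_val (u j) (P l))"
      unfolding obs_eq by (rule expectation_pauli_sum) (use P uc in \<open>simp_all only: N_def\<close>)
    moreover have "\<dots> = complex_of_real ?C * b j j"
      using C by (simp add: b_def B.matrix_element_def expectation_val_def sum_distrib_left)
    ultimately show ?thesis by (simp add: complex_eq_iff)
  qed

  define \<rho> where "\<rho> = (\<Sum>i\<in>{..<N} - {j}. (cmod (cooled i))\<^sup>2)"
  \<comment> \<open>The target has shift zero, so cooling leaves its amplitude unchanged.\<close>
  have cooled_j: "(cmod (cooled j))\<^sup>2 = p" by (simp add: cooled_def shift_def p_amp)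
  have D: "(\<Sum>i<N. (cmod (cooled i))\<^sup>2) = p + \<rho>"
    unfolding \<rho>_def cooled_j[symmetric] using jN by (subst sum.remove[of _ j]) auto
  have \<rho>0: "0 \<le> \<rho>" unfolding \<rho>_def by (simp add: sum_nonneg)
  have \<tau>\<Delta>: "\<tau> * \<Delta> = 2000 * ln (1 / s) / x\<^sub>m" using \<Delta> by (simp add: \<tau>_def \<Delta>_def)
  have \<tau>0: "0 \<le> \<tau>" using \<Delta> s x\<^sub>m by (simp add: \<tau>_def \<Delta>_def)
  have "\<rho> \<le> (\<Sum>i\<in>{..<N} - {j}. exp (- 2 * (\<tau> * \<Delta>)\<^sup>2) * (cmod (amp i))\<^sup>2)"
    unfolding \<rho>_def
  proof (rule sum_mono)
    fix i assume "i \<in> {..<N} - {j}"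
    then have "\<tau> * \<Delta> \<le> \<bar>shift i\<bar>"
      unfolding shift_def abs_mult using gap[of i] \<tau>0 by (simp add: mult_left_mono)
    then have "(\<tau> * \<Delta>)\<^sup>2 \<le> (shift i)\<^sup>2"
      using \<tau>0 \<Delta> by (subst abs_le_square_iff[symmetric]) simp
    then have "exp (- 2 * (shift i)\<^sup>2) \<le> exp (- 2 * (\<tau> * \<Delta>)\<^sup>2)" by simp
    moreover have "(cmod (cooled i))\<^sup>2 = exp (- 2 * (shift i)\<^sup>2) * (cmod (amp i))\<^sup>2"
      by (simp add: cooled_def norm_mult power_mult_distrib exp_double[symmetric])
    ultimately show "(cmod (cooled i))\<^sup>2 \<le> exp (- 2 * (\<tau> * \<Delta>)\<^sup>2) * (cmod (amp i))\<^sup>2"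
      by (simp only: mult_right_mono zero_le_power2)
  qed
  also have "\<dots> = exp (- 2 * (\<tau> * \<Delta>)\<^sup>2) * (1 - p)"
  proof -
    have "(\<Sum>i<N. (cmod (amp i))\<^sup>2) = p + (\<Sum>i\<in>{..<N} - {j}. (cmod (amp i))\<^sup>2)"
      unfolding p_amp using jN by (subst sum.remove[of _ j]) auto
    then show ?thesis using amp_norm by (simp flip: sum_distrib_left)
  qed
  finally have leak: "2 * sqrt (p * \<rho>) + 2 * \<rho> \<le> 5 / 8 * s"
    unfolding s_def using \<rho>0 \<epsilon> p p1 by (intro leakage_bound) (simp_all add: \<tau>\<Delta> x\<^sub>m_def s_def)
  have conc: "\<bar>Re (sesq N b cooled cooled) - (p + \<rho>) * Re (b j j)\<bar> \<le> 2 * sqrt (p * \<rho>) + 2 * \<rho>"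
  proof -
    have "cmod (sesq N b cooled cooled - complex_of_real (p + \<rho>) * b j j) \<le> 2 * sqrt (p * \<rho>) + 2 * \<rho>"
      using contraction_concentrated[OF contr jN, of cooled] unfolding cooled_j \<rho>_def[symmetric] .
    moreover have "Re (sesq N b cooled cooled - complex_of_real (p + \<rho>) * b j j) =
        Re (sesq N b cooled cooled) - (p + \<rho>) * Re (b j j)" by simp
    ultimately show ?thesis using abs_Re_le_cmod order_trans by metis
  qed
  have T: "\<bar>Re (b j j)\<bar> \<le> 1"
    using contraction_diag[OF contr jN] abs_Re_le_cmod[of "b j j"] by linarith
  note trunc = truncation_bound[OF s, folded x\<^sub>m_def]

  let ?S1 = "denominator_sample gaussian_cooling \<tau> x\<^sub>m H (E j) \<psi>"
  let ?S2 = "numerator_sample gaussian_cooling \<tau> x\<^sub>m H (E j) \<psi> L c P"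
  note num = numerator[of L c P, OF L P, folded b_def]
  show "1 - \<delta> \<le> measure R {\<omega> \<in> space R.
    estimation_succeeds m (expectation_val (u j) obs) (\<epsilon> * ?C) \<omega>}"
    unfolding R_def estimation_run_def
  proof (rule run_success_probability[where C = ?C and t = "s / 16"])
    \<comment> \<open>Origin of 2048: the tolerance \<open>s / 16\<close> turns the Hoeffding
      exponent into \<open>real m * s\<^sup>2 / (8 * 16\<^sup>2)\<close>.\<close>
    have "- real m * (s / 16)\<^sup>2 / 8 \<le> - ln (4 / \<delta>)" using m(2) by (simp add: power_divide)
    then have "exp (- real m * (s / 16)\<^sup>2 / 8) \<le> exp (- ln (4 / \<delta>))" by simp
    also have "\<dots> = \<delta> / 4" using \<delta> by (simp add: exp_minus)
    finally show "2 * exp (- real m * (s / 16)\<^sup>2 / 8) \<le> \<delta> / 2" by simp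
  next
    fix d e
    assume d: "\<bar>d - (LINT x|?S1. x)\<bar> < s / 16" and e: "\<bar>e - (LINT x|?S2. x)\<bar> < ?C * (s / 16)"
    \<comment> \<open>The tolerance \<open>s / 8\<close> is shared equally by fluctuation and
      truncation; likewise for \<open>e\<close>, scaled by \<open>?C\<close>.\<close>
    have d': "\<bar>d - (p + \<rho>)\<bar> \<le> \<epsilon> * p / 8"
      using d denominator(4) trunc(1) unfolding D s_def[symmetric] by linarith
    have "?C * (4 * exp (- x\<^sub>m\<^sup>2 / 4)) \<le> ?C * (s / 16)"
      using trunc(2) C by (intro mult_left_mono) auto
    moreover have "?C * (s / 16) + ?C * (s / 16) = ?C * (s / 8)" by simp
    ultimately have e': "\<bar>e - ?C * Re (sesq N b cooled cooled)\<bar> \<le> ?C * (\<epsilon> * p / 8)"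
      using e num(4) unfolding s_def[symmetric] by linarith
    note r = ratio_error[OF C \<epsilon> p _ d' e' conc leak[unfolded s_def] T]
    have "d \<noteq> 0" "\<bar>e / d - ?C * Re (b j j)\<bar> \<le> \<epsilon> * ?C" using r \<rho>0 by simp_all
    then show "d \<noteq> 0 \<and> cmod (complex_of_real (e / d) - expectation_val (u j) obs) \<le> \<epsilon> * ?C"
      unfolding target by (simp only: norm_of_real not_False_eq_True simp_thms flip: of_real_diff)
  qed (use denominator num C m(1) s \<delta> in simp_all)
qed

theorem proposition1:
  fixes \<delta> :: real
  assumes "0 < \<delta>" and "\<delta> < 1"
  shows "\<exists>(\<tau> :: real \<times> real \<times> real \<Rightarrow> real) (x\<^sub>m :: real \<times> real \<times> real \<Rightarrow> real)
      (N\<^sub>M :: real \<times> real \<times> real \<Rightarrow> nat).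
    (\<lambda>q. \<tau> q * x\<^sub>m q) \<in> O[principal cooling_parameters](\<lambda>(\<Delta>, \<epsilon>, p). inverse \<Delta> * ln (1 / (\<epsilon> * p))) \<and>
    (\<lambda>q. real (N\<^sub>M q)) \<in> O[principal cooling_parameters](\<lambda>(\<Delta>, \<epsilon>, p). 1 / (\<epsilon> * p)\<^sup>2) \<and>
    (\<forall>q\<in>cooling_parameters. 0 < \<tau> q \<and> 0 < x\<^sub>m q \<and> 0 < N\<^sub>M q) \<and>
    (\<forall>n H E u j \<psi> obs L c P \<epsilon> q.
       0 < n \<longrightarrow>
       H \<in> carrier_mat (2 ^ n) (2 ^ n) \<longrightarrow> hermitian_mat H \<longrightarrow>
       eigensystem n H E u \<longrightarrow> j < 2 ^ n \<longrightarrow>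
       \<psi> \<in> carrier_vec (2 ^ n) \<longrightarrow> braket \<psi> \<psi> = 1 \<longrightarrow> 0 < (cmod (braket (u j) \<psi>))\<^sup>2 \<longrightarrow>
       pauli_observable n obs L c P \<longrightarrow>
       0 < \<epsilon> \<longrightarrow> \<epsilon> < 1 \<longrightarrow>
       q = (spectral_gap n E j, \<epsilon>, (cmod (braket (u j) \<psi>))\<^sup>2) \<longrightarrow>
       (let R = estimation_run gaussian_cooling (\<tau> q) (x\<^sub>m q) (N\<^sub>M q) H (E j) \<psi> L c P in
        measure R {\<omega> \<in> space R.
          estimation_succeeds (N\<^sub>M q) (expectation_val (u j) obs) (\<epsilon> * one_norm L c) \<omega>}
        \<ge> 1 - \<delta>))"
proof -
  define X where "X = (\<lambda>(\<Delta>::real, \<epsilon>::real, p::real). sqrt (8 * ln (64 / (\<epsilon> * p))))"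
  define T where "T = (\<lambda>(\<Delta>::real, \<epsilon>::real, p::real). 2000 * ln (1 / (\<epsilon> * p)) / (\<Delta> * sqrt (8 * ln (64 / (\<epsilon> * p)))))"
  define K where "K = 2048 * ln (4 / \<delta>)"
  define M where "M = (\<lambda>(\<Delta>::real, \<epsilon>::real, p::real). nat \<lceil>K / (\<epsilon> * p)\<^sup>2\<rceil>)"
  have K: "0 < K" using assms by (simp add: K_def)
  have s: "0 < \<epsilon> * p" "\<epsilon> * p < 1" "0 < ln (1 / (\<epsilon> * p))" "0 < sqrt (8 * ln (64 / (\<epsilon> * p)))"
    if "(\<Delta>, \<epsilon>, p) \<in> cooling_parameters" for \<Delta> \<epsilon> p
  proof -
    have "\<epsilon> * p \<le> \<epsilon>" using that by (simp add: cooling_parameters_def mult_left_le)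
    moreover have "\<epsilon> < 1" using that by (simp add: cooling_parameters_def)
    ultimately show s1: "\<epsilon> * p < 1" by (rule le_less_trans)
    show s0: "0 < \<epsilon> * p" using that by (simp add: cooling_parameters_def)
    show "0 < ln (1 / (\<epsilon> * p))" "0 < sqrt (8 * ln (64 / (\<epsilon> * p)))" using s0 s1 by simp_all
  qed
  have M: "K / (\<epsilon> * p)\<^sup>2 \<le> real (M (\<Delta>, \<epsilon>, p))" "0 < M (\<Delta>, \<epsilon>, p)"
    "real (M (\<Delta>, \<epsilon>, p)) \<le> (K + 1) * (1 / (\<epsilon> * p)\<^sup>2)"
    if q: "(\<Delta>, \<epsilon>, p) \<in> cooling_parameters" for \<Delta> \<epsilon> p
  proof -
    note s = s[OF q]
    have pos: "0 < K / (\<epsilon> * p)\<^sup>2" using K s(1) by (intro divide_pos_pos zero_less_power)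
    have M: "real (M (\<Delta>, \<epsilon>, p)) = real_of_int \<lceil>K / (\<epsilon> * p)\<^sup>2\<rceil>"
      using pos by (simp add: M_def)
    show "K / (\<epsilon> * p)\<^sup>2 \<le> real (M (\<Delta>, \<epsilon>, p))" unfolding M by (rule le_of_int_ceiling)
    with pos have "0 < real (M (\<Delta>, \<epsilon>, p))" by (rule less_le_trans)
    then show "0 < M (\<Delta>, \<epsilon>, p)" by simp
    \<comment> \<open>Rounding up adds at most 1, which \<open>1 / (\<epsilon> * p)\<^sup>2\<close>
      dominates; this gives the constant \<open>K + 1\<close>.\<close>
    have "(\<epsilon> * p)\<^sup>2 \<le> 1" using s by (simp add: power_le_one)
    then have "1 \<le> 1 / (\<epsilon> * p)\<^sup>2" using zero_less_power[OF s(1), of 2] by (simp only: pos_le_divide_eq mult_1)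
    moreover have "real (M (\<Delta>, \<epsilon>, p)) \<le> K / (\<epsilon> * p)\<^sup>2 + 1"
      unfolding M using ceiling_correct[of "K / (\<epsilon> * p)\<^sup>2"] by linarith
    moreover have "(K + 1) * (1 / (\<epsilon> * p)\<^sup>2) = K / (\<epsilon> * p)\<^sup>2 + 1 / (\<epsilon> * p)\<^sup>2"
      by (simp add: add_divide_distrib)
    ultimately show "real (M (\<Delta>, \<epsilon>, p)) \<le> (K + 1) * (1 / (\<epsilon> * p)\<^sup>2)" by linarith
  qed
  have time: "(\<lambda>q. T q * X q) \<in> O[principal cooling_parameters](\<lambda>(\<Delta>, \<epsilon>, p). inverse \<Delta> * ln (1 / (\<epsilon> * p)))"
  proof (rule bigoI[where c = 2000])
    \<comment> \<open>The cutoff cancels in the product, so the time bound is an equality with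
      constant 2000 at every admissible triple.\<close>
    have eq: "T q * X q = 2000 * (case q of (\<Delta>, \<epsilon>, p) \<Rightarrow> inverse \<Delta> * ln (1 / (\<epsilon> * p)))"
      if q: "q \<in> cooling_parameters" for q
    proof -
      obtain \<Delta> \<epsilon> p where eq: "q = (\<Delta>, \<epsilon>, p)" by (cases q)
      show ?thesis using s(4)[OF q[unfolded eq]] unfolding eq T_def X_def prod.case by (simp add: divide_simps)
    qed
    show "\<forall>\<^sub>F q in principal cooling_parameters. norm (T q * X q) \<le>
        2000 * norm (case q of (\<Delta>, \<epsilon>, p) \<Rightarrow> inverse \<Delta> * ln (1 / (\<epsilon> * p)))"
      unfolding eventually_principal
      by (intro ballI) (simp only: eq norm_mult real_norm_def abs_numeral order_refl)
  qed
  have samples: "(\<lambda>q. real (M q)) \<in> O[principal cooling_parameters](\<lambda>(\<Delta>, \<epsilon>, p). 1 / (\<epsilon> * p)\<^sup>2)"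
  proof (rule bigoI[where c = "K + 1"])
    show "\<forall>\<^sub>F q in principal cooling_parameters. norm (real (M q)) \<le>
        (K + 1) * norm (case q of (\<Delta>, \<epsilon>, p) \<Rightarrow> 1 / (\<epsilon> * p)\<^sup>2)"
      using M(3) by (auto simp: eventually_principal)
  qed
  have pos: "0 < T q \<and> 0 < X q \<and> 0 < M q" if q: "q \<in> cooling_parameters" for q
  proof -
    obtain \<Delta> \<epsilon> p where eq: "q = (\<Delta>, \<epsilon>, p)" by (cases q)
    note s = s[OF q[unfolded eq]]
    have "0 < \<Delta>" using q by (simp add: eq cooling_parameters_def)
    then show ?thesis
      using s M(2)[OF q[unfolded eq]] unfolding eq T_def X_def prod.case
      by (intro conjI divide_pos_pos mult_pos_pos) simp_all
  qed
  show ?thesis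
  proof (intro exI conjI)
    show "\<forall>n H E u j \<psi> obs L c P \<epsilon> q.
       0 < n \<longrightarrow>
       H \<in> carrier_mat (2 ^ n) (2 ^ n) \<longrightarrow> hermitian_mat H \<longrightarrow>
       eigensystem n H E u \<longrightarrow> j < 2 ^ n \<longrightarrow>
       \<psi> \<in> carrier_vec (2 ^ n) \<longrightarrow> braket \<psi> \<psi> = 1 \<longrightarrow> 0 < (cmod (braket (u j) \<psi>))\<^sup>2 \<longrightarrow>
       pauli_observable n obs L c P \<longrightarrow>
       0 < \<epsilon> \<longrightarrow> \<epsilon> < 1 \<longrightarrow>
       q = (spectral_gap n E j, \<epsilon>, (cmod (braket (u j) \<psi>))\<^sup>2) \<longrightarrow>
       (let R = estimation_run gaussian_cooling (T q) (X q) (M q) H (E j) \<psi> L c P in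
        measure R {\<omega> \<in> space R.
          estimation_succeeds (M q) (expectation_val (u j) obs) (\<epsilon> * one_norm L c) \<omega>}
        \<ge> 1 - \<delta>)"
    proof (intro allI impI)
      fix n H E u j \<psi> obs L c P q and \<epsilon> :: real
      assume n: "0 < (n::nat)" and H: "H \<in> carrier_mat (2 ^ n) (2 ^ n)" "hermitian_mat H"
        and eig: "eigensystem n H E u" and j: "j < 2 ^ n"
        and \<psi>: "\<psi> \<in> carrier_vec (2 ^ n)" "braket \<psi> \<psi> = 1" and p: "0 < (cmod (braket (u j) \<psi>))\<^sup>2"
        and obs: "pauli_observable n obs L c P" and \<epsilon>: "0 < \<epsilon>" "\<epsilon> < 1"
        and q: "q = (spectral_gap n E j, \<epsilon>, (cmod (braket (u j) \<psi>))\<^sup>2)"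
      note success = cooling_success[where u = u and j = j and E = E, OF n H(1) eig j \<psi> p obs \<epsilon> assms]
      let ?p = "(cmod (braket (u j) \<psi>))\<^sup>2"
      have "0 < spectral_gap n E j"
        using eig by (intro spectral_gap_pos[OF _ j n]) (simp add: eigensystem_def)
      moreover have "?p \<le> 1"
        by (rule eigenbasis.overlap_le_one[OF eigensystem_eigenbasis[OF H(1) eig] \<psi> j])
      ultimately have mem: "q \<in> cooling_parameters"
        using \<epsilon> p by (simp add: q cooling_parameters_def)
      note mem' = mem[unfolded q]
      have "2048 * ln (4 / \<delta>) \<le> real (M q) * (\<epsilon> * ?p)\<^sup>2"
        using M(1)[OF mem'] s(1)[OF mem'] unfolding K_def[symmetric] q
        by (simp only: pos_divide_le_eq zero_less_power)
      from success[OF M(2)[OF mem', folded q] this]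
      show "let R = estimation_run gaussian_cooling (T q) (X q) (M q) H (E j) \<psi> L c P in
        measure R {\<omega> \<in> space R.
          estimation_succeeds (M q) (expectation_val (u j) obs) (\<epsilon> * one_norm L c) \<omega>}
        \<ge> 1 - \<delta>"
        unfolding Let_def by (simp only: q T_def X_def prod.case)
    qed
  qed (use time samples pos in blast)+
qed

end
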